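(* Let $d\ge2$ and $n\ge1$ be integers, let $\varphi\in\mathcal{O}(2/(d+2))$, and let $\lambda_1,\dots,\lambda_n\ge0$ with $\sum_{i=1}^n\lambda_i=1$. Assume that $\mu_i=G_\varphi(0,A_i)$ with $A_i\in\mathbb{S}(d,\mathbb{R})_+$ for $i=1,\dots,n$. Then the barycenter problem $$\min_{\mu\in\mathcal{P}_2(\mathbb{R}^d)}\ \sum_{i=1}^n\frac{\lambda_i}{2}W_2^2(\mu,\mu_i)$$ has a unique solution $\mu=G_\varphi(0,X)$, where the covariance matrix $X\in\mathbb{S}(d,\mathbb{R})_+$ solves the nonlinear matrix equation $$X=\sum_{i=1}^n\lambda_i\big(X^{1/2}A_iX^{1/2}\big)^{1/2}.$$ In particular, for $n=2$, $X$ is given explicitly by $$X=\lambda_1^2A_1+\lambda_2^2A_2+\lambda_1\lambda_2\Big[(A_1A_2)^{1/2}+(A_2A_1)^{1/2}\Big].$$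
   Context: $\mathbb{S}(d,\mathbb{R})_+$ is the set of real symmetric positive definite $d\times d$ matrices; $X^{1/2}$ is the symmetric positive definite square root of $X\in\mathbb{S}(d,\mathbb{R})_+$; for $A,B\in\mathbb{S}(d,\mathbb{R})_+$, $(AB)^{1/2}$ is the principal square root (the unique square root with positive eigenvalues) of $AB$, whose eigenvalues are positive. $\mathcal{P}_2(\mathbb{R}^d)$ is the set of Borel probability measures on $\mathbb{R}^d$ with finite second moment; $W_2^2(\mu,\nu)=\inf_\pi\int|x-y|^2\,\pi(dx,dy)$ over all couplings $\pi$ of $\mu$ and $\nu$. For an increasing, positive, continuous function $\varphi$ on $(0,\infty)$, let $\ln_\varphi(t)=\int_1^t\frac{ds}{\varphi(s)}$, $l_\varphi=\inf_{t>0}\ln_\varphi(t)$, $L_\varphi=\sup_{t>0}\ln_\varphi(t)$, and let $\exp_\varphi(s)=0$ for $s\le l_\varphi$, $\exp_\varphi(s)=\ln_\varphi^{-1}(s)$ for $s\in(l_\varphi,L_\varphi)$, $\exp_\varphi(s)=\infty$ for $s\ge L_\varphi$. For $a\in\mathbb{R}$, $\mathcal{O}(a)$ is the set of all increasing, positive, continuous functions $\varphi$ on $(0,\infty)$ with $\max\{\delta_\varphi,\delta^\varphi\}<a$, where $$\delta_\varphi=\inf\Big\{\delta\in\mathbb{R}:\lim_{s\downarrow0}\tfrac{s^{1+\delta}}{\varphi(s)}\text{ exists}\Big\},\qquad \delta^\varphi=\inf\Big\{\delta\in\mathbb{R}:\lim_{s\uparrow\infty}\tfrac{s^{1+\delta}}{\varphi(s)}=\infty\Big\}.$$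 For $\varphi\in\mathcal{O}(2/(d+2))$ it is known that there are constants $\lambda_\varphi,c_\varphi$ (depending only on $\varphi$ and $d$) such that for all $(v,V)\in\mathbb{R}^d\times\mathbb{S}(d,\mathbb{R})_+$ the function $$g_\varphi(v,V)(x)=\exp_\varphi\big(\lambda_\varphi-c_\varphi\langle x-v,V^{-1}(x-v)\rangle\big)(\det V)^{-1/2}$$ is a probability density on $\mathbb{R}^d$ with mean $v$ and covariance matrix $V$; $G_\varphi(v,V)$ denotes the corresponding measure, the $\varphi$-exponential measure with mean $v$ and covariance matrix $V$. *)

theory Defs
  imports "HOL-Probability.Probability"
begin

section \<open>Matrices\<close>

definition spd :: "(real^'n^'n) set" where
  "spd = {V. transpose V = V \<and> (\<forall>x. x \<noteq> 0 \<longrightarrow> x \<bullet> (V *v x) > 0)}"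

definition spd_sqrt :: "real^'n^'n \<Rightarrow> real^'n^'n" where
  "spd_sqrt V = (THE S. S \<in> spd \<and> S ** S = V)"

text \<open>Eigenvalues of a real matrix are understood over the complex numbers; otherwise a real
  matrix without any real eigenvalue would satisfy the condition on eigenvalues in
  \<open>principal_sqrt\<close> vacuously.\<close>

definition eigenvalues :: "real^'n^'n \<Rightarrow> complex set" where
  "eigenvalues S = {z. \<exists>u. u \<noteq> 0 \<and> (\<chi> i j. complex_of_real (S $ i $ j)) *v u = z *s u}"

definition principal_sqrt :: "real^'n^'n \<Rightarrow> real^'n^'n" where
  "principal_sqrt M =
    (THE S. S ** S = M \<and> (\<forall>z\<in>eigenvalues S. z \<in> \<real> \<and> Re z > 0))"


section \<open>Wasserstein space and barycenters\<close>

definition P2 :: "(real^'n) measure set" where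
  "P2 = {\<mu>. prob_space \<mu> \<and> sets \<mu> = sets borel \<and> integrable \<mu> (\<lambda>x. (norm x)\<^sup>2)}"

definition couplings ::
    "(real^'n) measure \<Rightarrow> (real^'n) measure \<Rightarrow> ((real^'n) \<times> (real^'n)) measure set" where
  "couplings \<mu> \<nu> = {\<pi>. prob_space \<pi> \<and> sets \<pi> = sets borel \<and>
     distr \<pi> borel fst = \<mu> \<and> distr \<pi> borel snd = \<nu>}"

definition W2_squared :: "(real^'n) measure \<Rightarrow> (real^'n) measure \<Rightarrow> ennreal" where
  "W2_squared \<mu> \<nu> =
    (INF \<pi>\<in>couplings \<mu> \<nu>. \<integral>\<^sup>+ p. ennreal ((norm (fst p - snd p))\<^sup>2) \<partial>\<pi>)"

definition barycenter_cost ::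
    "nat \<Rightarrow> (nat \<Rightarrow> real) \<Rightarrow> (nat \<Rightarrow> (real^'n) measure) \<Rightarrow> (real^'n) measure \<Rightarrow> ennreal" where
  "barycenter_cost n w m \<mu> = (\<Sum>i=1..n. ennreal (w i / 2) * W2_squared \<mu> (m i))"

definition is_barycenter ::
    "nat \<Rightarrow> (nat \<Rightarrow> real) \<Rightarrow> (nat \<Rightarrow> (real^'n) measure) \<Rightarrow> (real^'n) measure \<Rightarrow> bool" where
  "is_barycenter n w m \<mu> \<longleftrightarrow>
    \<mu> \<in> P2 \<and> (\<forall>\<nu>\<in>P2. barycenter_cost n w m \<mu> \<le> barycenter_cost n w m \<nu>)"


section \<open>Deformed logarithm and exponential\<close>

text \<open>A function on the half line \<open>(0, \<infinity>)\<close> is represented by a total function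
  whose values at nonpositive arguments are irrelevant.\<close>

definition ln_phi :: "(real \<Rightarrow> real) \<Rightarrow> real \<Rightarrow> real" where
  "ln_phi \<phi> t = (LBINT s=1..t. 1 / \<phi> s)"

definition l_phi :: "(real \<Rightarrow> real) \<Rightarrow> ereal" where
  "l_phi \<phi> = (INF t\<in>{0<..}. ereal (ln_phi \<phi> t))"

definition L_phi :: "(real \<Rightarrow> real) \<Rightarrow> ereal" where
  "L_phi \<phi> = (SUP t\<in>{0<..}. ereal (ln_phi \<phi> t))"

definition exp_phi :: "(real \<Rightarrow> real) \<Rightarrow> real \<Rightarrow> ennreal" where
  "exp_phi \<phi> s =
    (if ereal s \<le> l_phi \<phi> then 0
     else if L_phi \<phi> \<le> ereal s then \<infinity>
     else ennreal (the_inv_into {0<..} (ln_phi \<phi>) s))"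

text \<open>The two infima are taken in the extended reals, with value \<open>\<infinity>\<close> for the empty set.
  Existence of the limit at \<open>0\<close> means existence of a finite limit.\<close>

definition delta_low :: "(real \<Rightarrow> real) \<Rightarrow> ereal" where
  "delta_low \<phi> =
    (INF \<delta>\<in>{\<delta>. \<exists>L::real. ((\<lambda>s. s powr (1 + \<delta>) / \<phi> s) \<longlongrightarrow> L) (at_right 0)}. ereal \<delta>)"

definition delta_up :: "(real \<Rightarrow> real) \<Rightarrow> ereal" where
  "delta_up \<phi> =
    (INF \<delta>\<in>{\<delta>. filterlim (\<lambda>s. s powr (1 + \<delta>) / \<phi> s) at_top at_top}. ereal \<delta>)"

definition phi_class :: "real \<Rightarrow> (real \<Rightarrow> real) set" where
  "phi_class a = {\<phi>. mono_on {0<..} \<phi> \<and> (\<forall>s>0. \<phi> s > 0) \<and> continuous_on {0<..} \<phi> \<and>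
     max (delta_low \<phi>) (delta_up \<phi>) < ereal a}"


section \<open>Deformed exponential measures\<close>

definition g_phi ::
    "(real \<Rightarrow> real) \<Rightarrow> real \<Rightarrow> real \<Rightarrow> real^'n \<Rightarrow> real^'n^'n \<Rightarrow> real^'n \<Rightarrow> ennreal" where
  "g_phi \<phi> l c v V x =
    exp_phi \<phi> (l - c * ((x - v) \<bullet> (matrix_inv V *v (x - v)))) * ennreal (det V powr (-1/2))"

definition G_phi ::
    "(real \<Rightarrow> real) \<Rightarrow> real \<Rightarrow> real \<Rightarrow> real^'n \<Rightarrow> real^'n^'n \<Rightarrow> (real^'n) measure" where
  "G_phi \<phi> l c v V = density lborel (g_phi \<phi> l c v V)"

definition has_mean_covariance :: "(real^'n) measure \<Rightarrow> real^'n \<Rightarrow> real^'n^'n \<Rightarrow> bool" where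
  "has_mean_covariance \<mu> v V \<longleftrightarrow>
    integrable \<mu> (\<lambda>x. x) \<and> (\<integral>x. x \<partial>\<mu>) = v \<and>
    (\<forall>i j. integrable \<mu> (\<lambda>x. (x $ i - v $ i) * (x $ j - v $ j)) \<and>
           (\<integral>x. (x $ i - v $ i) * (x $ j - v $ j) \<partial>\<mu>) = V $ i $ j)"

text \<open>The defining property of the pair \<open>(\<lambda>\<^sub>\<phi>, c\<^sub>\<phi>)\<close>. It is the same pair for all
  \<open>v\<close> and \<open>V\<close>; the type argument supplies the dimension.\<close>

definition phi_constants :: "'n::finite itself \<Rightarrow> (real \<Rightarrow> real) \<Rightarrow> real \<Rightarrow> real \<Rightarrow> bool" where
  "phi_constants _ \<phi> l c \<longleftrightarrow>
    (\<forall>(v::real^'n) V. V \<in> spd \<longrightarrow>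
       prob_space (G_phi \<phi> l c v V) \<and> has_mean_covariance (G_phi \<phi> l c v V) v V)"

end

theory Submission
  imports Defs
begin

text \<open>
  Everything rests on one set of matrices. Let \<open>X\<close> solve the matrix equation and put
  \<open>R = X\<^sup>1\<^sup>/\<^sup>2\<close> and \<open>T\<^sub>i = R\<^sup>-\<^sup>1 (R A\<^sub>i R)\<^sup>1\<^sup>/\<^sup>2 R\<^sup>-\<^sup>1\<close>. Each \<open>T\<^sub>i\<close> is symmetric positive
  definite with \<open>T\<^sub>i X T\<^sub>i = A\<^sub>i\<close>, and the matrix equation says exactly that
  \<open>\<Sum>\<^sub>i \<lambda>\<^sub>i T\<^sub>i = I\<close> (\<open>transport_matrices\<close>). A linear map carries one member of the family
  \<open>G(0, \<cdot>)\<close> to another (\<open>distr_G_phi_matrix\<close>), so \<open>T\<^sub>i\<close> pushes \<open>G(0, X)\<close> forward to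
  \<open>\<mu>\<^sub>i = G(0, A\<^sub>i)\<close>.

  What remains is a duality argument for arbitrary measures (\<open>barycenter_of_linear_images\<close>).
  For positive definite \<open>T\<close> one has the pointwise identity
  \<open>|x - y|\<^sup>2 = (|x|\<^sup>2 - \<langle>x, T x\<rangle>) + (|y|\<^sup>2 - \<langle>y, T\<^sup>-\<^sup>1 y\<rangle>) + \<langle>z, T z\<rangle>\<close> with
  \<open>z = x - T\<^sup>-\<^sup>1 y\<close>. Integrated against a coupling of \<open>\<nu>\<close> and \<open>\<mu>\<^sub>i\<close> with \<open>T = T\<^sub>i\<close>, weighted by
  \<open>\<lambda>\<^sub>i\<close> and summed, the first bracket cancels because \<open>\<Sum>\<^sub>i \<lambda>\<^sub>i T\<^sub>i = I\<close>, and the second depends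
  on the \<open>\<mu>\<^sub>i\<close> only. Hence the cost of every \<open>\<nu>\<close> is one and the same constant plus a
  nonnegative defect. For \<open>G(0, X)\<close> the couplings \<open>(x, T\<^sub>i x)\<close> have no defect, so it is a minimiser.
  For any minimiser the defect can be made arbitrarily small by the choice of the coupling
  with some \<open>\<mu>\<^sub>j\<close>, which bounds its distance to the image of \<open>\<mu>\<^sub>j\<close> under \<open>T\<^sub>j\<^sup>-\<^sup>1\<close>, that is,
  to \<open>G(0, X)\<close>; and measures at Wasserstein distance zero are equal
  (\<open>W2_squared_zero_imp_eq\<close>).

  The matrix equation has a solution by Brouwer's fixed point theorem on the compact convex set of
  symmetric matrices whose quadratic form lies between two positive multiples of \<open>|x|\<^sup>2\<close>
  (\<open>barycenter_equation_solvable\<close>). For two measures, \<open>\<lambda>\<^sub>1 T\<^sub>1 + \<lambda>\<^sub>2 T\<^sub>2 = I\<close> forces \<open>T\<^sub>1\<close> and \<open>T\<^sub>2\<close>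
  to commute unless a weight vanishes; then \<open>T\<^sub>1 X T\<^sub>2\<close> is the principal square root of \<open>A\<^sub>1 A\<^sub>2\<close>, and
  the explicit formula is the expansion of
  \<open>X = (\<lambda>\<^sub>1 T\<^sub>1 + \<lambda>\<^sub>2 T\<^sub>2) X (\<lambda>\<^sub>1 T\<^sub>1 + \<lambda>\<^sub>2 T\<^sub>2)\<close>.
\<close>

section \<open>Eigenvectors of symmetric matrices\<close>

lemma inner_matrix_vector_transpose:
  fixes M :: "real^'n^'m"
  shows "x \<bullet> (M *v y) = (transpose M *v x) \<bullet> y"
  by (simp add: dot_lmul_matrix)

lemma symmetric_matrix_iff:
  fixes M :: "real^'n^'n"
  shows "transpose M = M \<longleftrightarrow> (\<forall>x y. x \<bullet> (M *v y) = (M *v x) \<bullet> y)"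
proof
  assume "\<forall>x y. x \<bullet> (M *v y) = (M *v x) \<bullet> y"
  then have "(transpose M *v x) \<bullet> y = (M *v x) \<bullet> y" for x y
    by (simp only: inner_matrix_vector_transpose[symmetric])
  then have "transpose M *v x = M *v x" for x
    using vector_eq_rdot by blast
  then show "transpose M = M" unfolding matrix_eq by blast
next
  assume "transpose M = M"
  then show "\<forall>x y. x \<bullet> (M *v y) = (M *v x) \<bullet> y"
    by (simp only: inner_matrix_vector_transpose) simp
qed

text \<open>The Cauchy-Schwarz inequality for a semidefinite form: moving from \<open>v\<close> in the direction \<open>w\<close>
  changes the form to first order by \<open>2 t \<langle>w, N v\<rangle>\<close>,
  and the form stays nonnegative for both signs of \<open>t\<close>.\<close>

lemma semidefinite_null_vector:
  fixes N :: "real^'n^'n"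
  assumes sym: "transpose N = N" and W: "subspace W"
    and nonneg: "\<And>x. x \<in> W \<Longrightarrow> 0 \<le> x \<bullet> (N *v x)"
    and v: "v \<in> W" "v \<bullet> (N *v v) = 0" and w: "w \<in> W"
  shows "w \<bullet> (N *v v) = 0"
proof -
  define b q where "b = w \<bullet> (N *v v)" and "q = w \<bullet> (N *v w)"
  have q: "q \<ge> 0" using nonneg[OF w] by (simp add: q_def)
  have vw: "v \<bullet> (N *v w) = b"
    using sym by (simp add: b_def symmetric_matrix_iff inner_commute)
  \<comment> \<open>The minimiser of \<open>2 t b + t\<^sup>2 q\<close> would be \<open>- b / q\<close>; the shift by one also covers \<open>q = 0\<close>.\<close>
  define t where "t = - b / (q + 1)"
  have "v + t *\<^sub>R w \<in> W" using W v w by (simp add: subspace_add subspace_scale)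
  from nonneg[OF this] have "0 \<le> 2 * t * b + t\<^sup>2 * q"
    using v vw by (simp add: matrix_vector_right_distrib matrix_vector_mult_scaleR inner_add_left
        inner_add_right b_def[symmetric] q_def[symmetric] power2_eq_square algebra_simps)
  also have "2 * t * b + t\<^sup>2 * q = - (b\<^sup>2 * (q + 2)) / (q + 1)\<^sup>2"
    using q by (simp add: t_def power2_eq_square divide_simps) (simp add: algebra_simps)
  finally have "b\<^sup>2 * (q + 2) \<le> 0" using q by (simp add: divide_simps split: if_splits)
  then have "b\<^sup>2 \<le> 0" using q by (simp add: mult_le_0_iff)
  then show ?thesis by (simp add: b_def)
qed

text \<open>A minimiser \<open>v\<close> of the quadratic form on the unit sphere of \<open>W\<close>, with minimum \<open>r\<close>, is a null
  vector of the form of \<open>M - r I\<close>, which is nonnegative on \<open>W\<close>. So \<open>(M - r I) v\<close> is orthogonal to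
  \<open>W\<close>; as it also lies in \<open>W\<close>, it vanishes.\<close>

lemma symmetric_least_eigenvector:
  fixes M :: "real^'n^'n"
  assumes sym: "transpose M = M" and W: "subspace W" "W \<noteq> {0}"
    and inv: "\<And>x. x \<in> W \<Longrightarrow> M *v x \<in> W"
  obtains v r where "v \<in> W" "norm v = 1" "M *v v = r *\<^sub>R v"
    "\<And>x. x \<in> W \<Longrightarrow> r * (norm x)\<^sup>2 \<le> x \<bullet> (M *v x)"
proof -
  let ?S = "sphere 0 1 \<inter> W"
  obtain u where u: "u \<in> W" "u \<noteq> 0" using W subspace_0 by blast
  then have "(1 / norm u) *\<^sub>R u \<in> ?S" using W by (simp add: subspace_scale)
  moreover have "compact ?S" by (simp add: W closed_subspace compact_Int_closed)
  moreover have "continuous_on ?S (\<lambda>x. x \<bullet> (M *v x))" by (intro continuous_intros)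
  ultimately obtain v where v: "v \<in> ?S" and le: "\<And>x. x \<in> ?S \<Longrightarrow> v \<bullet> (M *v v) \<le> x \<bullet> (M *v x)"
    using continuous_attains_inf[of ?S "\<lambda>x. x \<bullet> (M *v x)"] by blast
  define r where "r = v \<bullet> (M *v v)"
  have bound: "r * (norm x)\<^sup>2 \<le> x \<bullet> (M *v x)" if "x \<in> W" for x
  proof (cases "x = 0")
    case False
    have "(1 / norm x) *\<^sub>R x \<in> ?S" using W False that by (simp add: subspace_scale)
    from le[OF this] have "r \<le> x \<bullet> (M *v x) / (norm x)\<^sup>2"
      by (simp add: r_def matrix_vector_mult_scaleR power2_eq_square)
    then show ?thesis using False by (simp add: divide_simps)
  qed simp
  define N where "N = M - r *\<^sub>R mat 1"
  have Nv: "N *v x = M *v x - r *\<^sub>R x" for x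
    by (simp add: N_def matrix_vector_mult_diff_rdistrib scaleR_matrix_vector_assoc[symmetric])
  have "N *v v \<in> W" using v inv W by (simp add: Nv subspace_diff subspace_scale)
  moreover have "transpose N = N" using sym
    by (simp add: symmetric_matrix_iff Nv inner_diff_left inner_diff_right)
  moreover have "0 \<le> x \<bullet> (N *v x)" if "x \<in> W" for x
    using bound[OF that] by (simp add: Nv inner_diff_right power2_norm_eq_inner)
  moreover have "v \<bullet> (N *v v) = 0" using v
    by (simp add: Nv inner_diff_right r_def[symmetric] norm_eq_1)
  ultimately have "(N *v v) \<bullet> (N *v v) = 0"
    using semidefinite_null_vector[of N W v "N *v v"] W v by simp
  then have "M *v v = r *\<^sub>R v" by (simp add: Nv)
  with that v bound show thesis by auto
qed

text \<open>An orthonormal set of eigenvectors of maximal cardinality spans the space: its orthogonal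
  complement is invariant, so otherwise it would contain one more eigenvector.\<close>

lemma symmetric_orthonormal_eigenbasis:
  fixes M :: "real^'n^'n"
  assumes sym: "transpose M = M"
  obtains B where "finite B" "pairwise orthogonal B" "\<And>b. b \<in> B \<Longrightarrow> norm b = 1"
    "\<And>b. b \<in> B \<Longrightarrow> \<exists>r. M *v b = r *\<^sub>R b" "\<And>x. x = (\<Sum>b\<in>B. (b \<bullet> x) *\<^sub>R b)"
proof -
  define P where "P B \<longleftrightarrow> pairwise orthogonal B \<and> (\<forall>b\<in>B. norm b = 1 \<and> (\<exists>r. M *v b = r *\<^sub>R b))"
    for B
  have card: "finite B \<and> card B \<le> DIM(real^'n)" if "P B" for B
  proof -
    have "0 \<notin> B" using that by (auto simp: P_def)
    then have "independent B" using that pairwise_orthogonal_independent by (auto simp: P_def)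
    then show ?thesis using independent_bound by blast
  qed
  have "P {}" by (simp add: P_def)
  moreover have "\<forall>B. P B \<longrightarrow> card B < Suc DIM(real^'n)" using card by (simp add: less_Suc_eq_le)
  ultimately have "\<exists>B. P B \<and> (\<forall>C. P C \<longrightarrow> card C \<le> card B)"
    by (rule ex_has_greatest_nat)
  then obtain B where B: "P B" and max: "\<And>C. P C \<Longrightarrow> card C \<le> card B" by blast
  have fin: "finite B" using card B by blast
  have orth: "b \<bullet> c = (if b = c then 1 else 0)" if "b \<in> B" "c \<in> B" for b c
    using B that by (auto simp: P_def pairwise_def orthogonal_def norm_eq_1)
  define W where "W = {x. \<forall>b\<in>B. b \<bullet> x = 0}"
  have W: "subspace W" by (auto simp: W_def subspace_def inner_add_right)
  have "M *v x \<in> W" if "x \<in> W" for x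
    unfolding W_def
  proof (clarify)
    fix b assume "b \<in> B"
    then obtain r where "M *v b = r *\<^sub>R b" using B by (auto simp: P_def)
    then show "b \<bullet> (M *v x) = 0"
      using sym that \<open>b \<in> B\<close> by (simp add: symmetric_matrix_iff W_def)
  qed
  have "W = {0}"
  proof (rule ccontr)
    assume "W \<noteq> {0}"
    with symmetric_least_eigenvector[OF sym W] \<open>\<And>x. x \<in> W \<Longrightarrow> M *v x \<in> W\<close>
    obtain v r where v: "v \<in> W" "norm v = 1" "M *v v = r *\<^sub>R v" by metis
    have "v \<notin> B" using v orth by (auto simp: W_def norm_eq_1)
    moreover have "P (insert v B)"
      using B v by (auto simp: P_def pairwise_insert orthogonal_def W_def inner_commute)
    ultimately show False using max[of "insert v B"] fin by simp
  qed
  have "x = (\<Sum>b\<in>B. (b \<bullet> x) *\<^sub>R b)" for x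
  proof -
    have "x - (\<Sum>b\<in>B. (b \<bullet> x) *\<^sub>R b) \<in> W"
      by (auto simp: W_def inner_diff_right inner_sum_right orth fin if_distrib cong: if_cong)
    then show ?thesis using \<open>W = {0}\<close> by simp
  qed
  with that fin B show thesis by (auto simp: P_def)
qed

section \<open>Positive definite matrices and their square roots\<close>

lemma spd_symmetric: "V \<in> spd \<Longrightarrow> transpose V = V"
  by (simp add: spd_def)

lemma spd_pos: "V \<in> spd \<Longrightarrow> x \<noteq> 0 \<Longrightarrow> x \<bullet> (V *v x) > 0"
  by (simp add: spd_def)

lemma spd_inner: "V \<in> spd \<Longrightarrow> x \<bullet> (V *v y) = (V *v x) \<bullet> y"
  using spd_symmetric symmetric_matrix_iff by blast

lemma spd_ker: "V \<in> spd \<Longrightarrow> V *v x = 0 \<longleftrightarrow> x = 0"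
  by (metis inner_zero_right less_irrefl matrix_vector_mult_0_right spd_pos)

lemma spd_eigenvalue_pos: "V \<in> spd \<Longrightarrow> V *v x = r *\<^sub>R x \<Longrightarrow> x \<noteq> 0 \<Longrightarrow> r > 0"
  using spd_pos[of V x] inner_ge_zero[of x] by (simp add: zero_less_mult_iff)

lemma spd_sqrt_exists:
  assumes V: "V \<in> spd"
  shows "\<exists>S\<in>spd. S ** S = V"
proof -
  obtain B where fin: "finite B" and po: "pairwise orthogonal B"
    and n1: "\<And>b. b \<in> B \<Longrightarrow> norm b = 1"
    and ev: "\<And>b. b \<in> B \<Longrightarrow> \<exists>r. V *v b = r *\<^sub>R b"
    and ex: "\<And>x. x = (\<Sum>b\<in>B. (b \<bullet> x) *\<^sub>R b)"
    using symmetric_orthonormal_eigenbasis[OF spd_symmetric[OF V]] by blast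
  obtain r where r: "\<And>b. b \<in> B \<Longrightarrow> V *v b = r b *\<^sub>R b" using ev by metis
  have rpos: "r b > 0" if "b \<in> B" for b
    using spd_eigenvalue_pos[OF V r[OF that]] n1[OF that] by (metis norm_zero zero_neq_one)
  have orth: "b \<bullet> c = (if b = c then 1 else 0)" if "b \<in> B" "c \<in> B" for b c
    using po n1 that by (auto simp: pairwise_def orthogonal_def norm_eq_1)
  \<comment> \<open>The map scaling each basis vector by the root of its eigenvalue.\<close>
  define f where "f x = (\<Sum>b\<in>B. (sqrt (r b) * (b \<bullet> x)) *\<^sub>R b)" for x
  have "linear f"
    by (rule linearI) (simp_all add: f_def inner_add_right distrib_left scaleR_add_left
        sum.distrib scaleR_sum_right mult_ac)
  define S where "S = matrix f"
  have S: "S *v x = f x" for x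
    using \<open>linear f\<close> by (simp add: S_def matrix_works)
  have inner_f: "x \<bullet> f y = (\<Sum>b\<in>B. sqrt (r b) * (b \<bullet> x) * (b \<bullet> y))" for x y
    by (simp add: f_def inner_sum_right inner_commute mult_ac)
  have "transpose S = S"
    unfolding symmetric_matrix_iff S
  proof (intro allI)
    fix x y
    show "x \<bullet> f y = f x \<bullet> y"
      by (subst inner_commute[of "f x"]) (simp add: inner_f mult_ac)
  qed
  moreover have "x \<bullet> (S *v x) > 0" if "x \<noteq> 0" for x
  proof -
    obtain b where "b \<in> B" "b \<bullet> x \<noteq> 0"
    proof -
      have "(\<Sum>b\<in>B. (b \<bullet> x) *\<^sub>R b) \<noteq> 0" using ex \<open>x \<noteq> 0\<close> by metis
      then obtain b where "b \<in> B" "(b \<bullet> x) *\<^sub>R b \<noteq> 0" by (rule sum.not_neutral_contains_not_neutral)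
      then show thesis using that by simp
    qed
    moreover have "sqrt (r b) * (b \<bullet> x) * (b \<bullet> x) \<ge> 0" if "b \<in> B" for b
      using rpos[OF that] by (simp add: mult.assoc)
    ultimately show ?thesis
      unfolding S inner_f using fin rpos
      by (intro sum_pos2[of _ b]) (auto simp: mult.assoc zero_less_mult_iff)
  qed
  ultimately have "S \<in> spd" by (simp add: spd_def)
  have fb: "f b = sqrt (r b) *\<^sub>R b" if "b \<in> B" for b
  proof -
    have "f b = (\<Sum>c\<in>B. if c = b then sqrt (r b) *\<^sub>R b else 0)"
      unfolding f_def using that by (intro sum.cong) (auto simp: orth)
    then show ?thesis using that fin by simp
  qed
  have "(S ** S) *v x = V *v x" for x
  proof -
    have "(S ** S) *v x = f (f x)" by (simp add: matrix_vector_mul_assoc[symmetric] S)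
    also have "\<dots> = (\<Sum>b\<in>B. (sqrt (r b) * (b \<bullet> x)) *\<^sub>R f b)"
      using \<open>linear f\<close> by (subst (2) f_def) (simp add: linear_sum linear_scale)
    also have "\<dots> = (\<Sum>b\<in>B. (b \<bullet> x) *\<^sub>R (V *v b))"
      using rpos by (intro sum.cong) (auto simp: fb r less_imp_le mult.commute mult.left_commute)
    also have "\<dots> = V *v (\<Sum>b\<in>B. (b \<bullet> x) *\<^sub>R b)"
      by (simp add: linear_sum[OF matrix_vector_mul_linear] matrix_vector_mult_scaleR)
    finally show ?thesis using ex by simp
  qed
  then show ?thesis using \<open>S \<in> spd\<close> by (auto simp: matrix_eq)
qed

text \<open>Each listed eigenvector \<open>v\<close> of \<open>T\<close>, with eigenvalue \<open>r\<close>, is killed by \<open>D\<close>: the equation gives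
  \<open>S (D v) = - r (D v)\<close>, and \<open>- r\<close> is not an eigenvalue of \<open>S\<close>. Two roots of the same matrix
  satisfy \<open>S (S - T) + (S - T) T = 0\<close>, so this gives uniqueness both of the positive definite
  root and of the principal root. \<open>S\<close> and \<open>T\<close> are
  arbitrary because a principal root need not be symmetric.\<close>

lemma sylvester_zero:
  fixes S T D :: "real^'n^'n"
  assumes eq: "S ** D + D ** T = 0"
    and span: "span {v. \<exists>r. T *v v = r *\<^sub>R v \<and> (\<forall>u. S *v u = - r *\<^sub>R u \<longrightarrow> u = 0)} = UNIV"
  shows "D = 0"
proof -
  have "D *v x = 0" for x
  proof -
    have "x \<in> span {v. \<exists>r. T *v v = r *\<^sub>R v \<and> (\<forall>u. S *v u = - r *\<^sub>R u \<longrightarrow> u = 0)}"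
      using span by simp
    then show ?thesis
    proof (induction rule: span_induct_alt)
      case (step c v y)
      then obtain r where r: "T *v v = r *\<^sub>R v" "\<And>u. S *v u = - r *\<^sub>R u \<Longrightarrow> u = 0" by auto
      have "S *v (D *v v) + D *v (T *v v) = 0"
        using arg_cong[OF eq, of "\<lambda>Z. Z *v v"]
        by (simp add: matrix_vector_mult_add_rdistrib matrix_vector_mul_assoc)
      then have "S *v (D *v v) = - r *\<^sub>R (D *v v)"
        using r(1) by (simp add: matrix_vector_mult_scaleR eq_neg_iff_add_eq_0)
      then have "D *v v = 0" by (rule r(2))
      with step show ?case by (simp add: matrix_vector_right_distrib matrix_vector_mult_scaleR)
    qed simp
  qed
  then show ?thesis by (simp add: matrix_eq)
qed

lemma spd_span_eigenvectors:
  fixes V :: "real^'n^'n"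
  assumes V: "V \<in> spd"
  shows "span {v. \<exists>r>0. V *v v = r *\<^sub>R v} = UNIV"
proof -
  obtain B where "finite B" "pairwise orthogonal B" and B: "\<And>b. b \<in> B \<Longrightarrow> norm b = 1"
    "\<And>b. b \<in> B \<Longrightarrow> \<exists>r. V *v b = r *\<^sub>R b" "\<And>x. x = (\<Sum>b\<in>B. (b \<bullet> x) *\<^sub>R b)"
    by (rule symmetric_orthonormal_eigenbasis[OF spd_symmetric[OF V]]) blast
  have "B \<subseteq> {v. \<exists>r>0. V *v v = r *\<^sub>R v}"
  proof
    fix b assume "b \<in> B"
    with B(1,2) obtain r where "V *v b = r *\<^sub>R b" "b \<noteq> 0" by (metis norm_zero zero_neq_one)
    with spd_eigenvalue_pos[OF V this] show "b \<in> {v. \<exists>r>0. V *v v = r *\<^sub>R v}" by auto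
  qed
  moreover have "x \<in> span B" for x
    by (subst B(3)[of x]) (intro span_sum span_scale span_base)
  ultimately show ?thesis using span_mono by blast
qed

lemma spd_sylvester_zero:
  fixes S T D :: "real^'n^'n"
  assumes S: "S \<in> spd" and T: "T \<in> spd" and eq: "S ** D + D ** T = 0"
  shows "D = 0"
proof (rule sylvester_zero[OF eq])
  have "u = 0" if "r > 0" "S *v u = - r *\<^sub>R u" for r u
    using spd_eigenvalue_pos[OF S that(2)] that by auto
  then have "{v. \<exists>r>0. T *v v = r *\<^sub>R v} \<subseteq>
      {v. \<exists>r. T *v v = r *\<^sub>R v \<and> (\<forall>u. S *v u = - r *\<^sub>R u \<longrightarrow> u = 0)}" by blast
  then show "span {v. \<exists>r. T *v v = r *\<^sub>R v \<and> (\<forall>u. S *v u = - r *\<^sub>R u \<longrightarrow> u = 0)} = UNIV"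
    using span_mono spd_span_eigenvectors[OF T] by blast
qed

lemma matrix_diff_ldistrib: "A ** (B - C) = A ** B - A ** (C :: real^'n^'m)"
  by (simp add: matrix_matrix_mult_def vec_eq_iff right_diff_distrib sum_subtractf)

lemma matrix_diff_rdistrib: "(B - C) ** A = B ** A - (C :: real^'n^'m) ** A"
  by (simp add: matrix_matrix_mult_def vec_eq_iff left_diff_distrib sum_subtractf)

lemma spd_root_unique:
  assumes S: "S \<in> spd" and T: "T \<in> spd" and eq: "S ** S = T ** T"
  shows "S = T"
proof -
  have "S ** (S - T) + (S - T) ** T = 0"
    by (simp add: matrix_diff_ldistrib matrix_diff_rdistrib eq)
  then show ?thesis using spd_sylvester_zero[OF S T, of "S - T"] by simp
qed

lemma
  assumes V: "V \<in> spd"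
  shows spd_sqrt_spd: "spd_sqrt V \<in> spd"
    and spd_sqrt_square: "spd_sqrt V ** spd_sqrt V = V"
proof -
  have "\<exists>!S. S \<in> spd \<and> S ** S = V"
    using spd_sqrt_exists[OF V] spd_root_unique by blast
  from theI'[OF this] show "spd_sqrt V \<in> spd" "spd_sqrt V ** spd_sqrt V = V"
    by (simp_all add: spd_sqrt_def)
qed

lemma spd_sqrt_unique:
  assumes "S \<in> spd"
  shows "spd_sqrt (S ** S) = S"
  unfolding spd_sqrt_def using assms spd_root_unique by blast

section \<open>Congruences, inverses and products\<close>

lemma spd_congruence:
  fixes V Q :: "real^'n^'n"
  assumes V: "V \<in> spd" and inj: "\<And>x. Q *v x = 0 \<Longrightarrow> x = 0"
  shows "transpose Q ** V ** Q \<in> spd"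
proof -
  have "x \<bullet> ((transpose Q ** V ** Q) *v x) = (Q *v x) \<bullet> (V *v (Q *v x))" for x
    by (simp only: matrix_vector_mul_assoc[symmetric] inner_matrix_vector_transpose[of x "transpose Q"]
        transpose_transpose)
  then show ?thesis
    using spd_pos[OF V] inj spd_symmetric[OF V]
    by (auto simp: spd_def matrix_transpose_mul matrix_mul_assoc)
qed

lemma spd_congruence_spd: "V \<in> spd \<Longrightarrow> Q \<in> spd \<Longrightarrow> Q ** V ** Q \<in> spd"
  using spd_congruence[of V Q] by (simp add: spd_ker spd_symmetric)

lemma spd_invertible: "V \<in> spd \<Longrightarrow> invertible V"
  by (metis invertible_left_inverse matrix_left_invertible_ker spd_ker)

lemma matrix_inv_left: "invertible (V :: real^'n^'n) \<Longrightarrow> matrix_inv V ** V = mat 1"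
  unfolding matrix_inv_def invertible_def by (rule someI2_ex) auto

lemma matrix_inv_right: "invertible (V :: real^'n^'n) \<Longrightarrow> V ** matrix_inv V = mat 1"
  unfolding matrix_inv_def invertible_def by (rule someI2_ex) auto

lemma matrix_inv_unique: "(V :: real^'n^'n) ** U = mat 1 \<Longrightarrow> matrix_inv V = U"
  by (metis invertible_right_inverse matrix_inv_left matrix_mul_assoc matrix_mul_lid matrix_mul_rid)

lemma spd_inverse:
  assumes V: "V \<in> spd" shows "matrix_inv V \<in> spd"
proof -
  let ?U = "matrix_inv V"
  have VU: "V ** ?U = mat 1" using V by (simp add: matrix_inv_right spd_invertible)
  have ker: "x = 0" if "?U *v x = 0" for x
    using arg_cong[OF VU, of "\<lambda>Z. Z *v x"] that by (simp add: matrix_vector_mul_assoc[symmetric])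
  have "transpose ?U ** V ** ?U \<in> spd" by (rule spd_congruence[OF V ker])
  moreover have "transpose ?U ** V = mat 1"
    using VU by (metis V matrix_transpose_mul spd_symmetric transpose_mat)
  ultimately show ?thesis by simp
qed

text \<open>The root \<open>R\<close> of \<open>S\<close> also commutes with \<open>T\<close>, so that \<open>S T = R T R\<close> is a congruence of \<open>T\<close>.\<close>

lemma spd_mult_commuting:
  assumes S: "S \<in> spd" and T: "T \<in> spd" and comm: "S ** T = T ** S"
  shows "S ** T \<in> spd"
proof -
  define R where "R = spd_sqrt S"
  have R: "R \<in> spd" "R ** R = S" using S by (simp_all add: R_def spd_sqrt_spd spd_sqrt_square)
  \<comment> \<open>This is \<open>S T - T S = 0\<close> with \<open>S = R\<^sup>2\<close>, and forces the commutator of \<open>R\<close> and \<open>T\<close> to vanish.\<close>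
  have "R ** (R ** T - T ** R) + (R ** T - T ** R) ** R = 0"
    using comm by (simp add: matrix_diff_ldistrib matrix_diff_rdistrib matrix_mul_assoc R(2))
      (simp add: matrix_mul_assoc[symmetric] R(2))
  then have "R ** T - T ** R = 0" by (rule spd_sylvester_zero[OF R(1) R(1)])
  then have "R ** T = T ** R" by simp
  then have "R ** (R ** T) = R ** (T ** R)" by (rule arg_cong)
  then have "S ** T = R ** T ** R" by (simp add: R(2) matrix_mul_assoc)
  then show ?thesis using spd_congruence_spd[OF T R(1)] by simp
qed

text \<open>A complex eigenvector is a pair of real vectors, its real and imaginary parts.\<close>

lemma eigenvalues_real_form:
  assumes "z \<in> eigenvalues S"
  obtains a b where "a \<noteq> 0 \<or> b \<noteq> 0"
    "S *v a = Re z *\<^sub>R a - Im z *\<^sub>R b" "S *v b = Re z *\<^sub>R b + Im z *\<^sub>R a"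
proof -
  obtain u where u: "u \<noteq> 0" "(\<chi> i j. complex_of_real (S $ i $ j)) *v u = z *s u"
    using assms by (auto simp: eigenvalues_def)
  define a b where "a = (\<chi> i. Re (u $ i))" and "b = (\<chi> i. Im (u $ i))"
  have comp: "(\<Sum>j\<in>UNIV. complex_of_real (S $ i $ j) * u $ j) = z * u $ i" for i
    using arg_cong[OF u(2), of "\<lambda>v. v $ i"] by (simp add: matrix_vector_mult_def)
  have "S *v a = Re z *\<^sub>R a - Im z *\<^sub>R b" "S *v b = Re z *\<^sub>R b + Im z *\<^sub>R a"
    using arg_cong[OF comp, of Re] arg_cong[OF comp, of Im]
    by (simp_all add: vec_eq_iff matrix_vector_mult_def a_def b_def)
  moreover have "a \<noteq> 0 \<or> b \<noteq> 0" using u(1) by (auto simp: a_def b_def vec_eq_iff complex_eq_iff)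
  ultimately show thesis using that by blast
qed

lemma real_eigenvalue_in_eigenvalues:
  assumes "S *v v = r *\<^sub>R v" "v \<noteq> 0"
  shows "complex_of_real r \<in> eigenvalues S"
proof -
  define u where "u = (\<chi> i. complex_of_real (v $ i))"
  have "(\<Sum>j\<in>UNIV. S $ i $ j * v $ j) = r * v $ i" for i
    using arg_cong[OF assms(1), of "\<lambda>v. v $ i"] by (simp add: matrix_vector_mult_def)
  then have "(\<chi> i j. complex_of_real (S $ i $ j)) *v u = complex_of_real r *s u"
    by (simp add: vec_eq_iff matrix_vector_mult_def u_def of_real_mult[symmetric] of_real_sum[symmetric]
        del: of_real_mult of_real_sum)
  moreover have "u \<noteq> 0" using assms(2) by (auto simp: u_def vec_eq_iff)
  ultimately show ?thesis by (auto simp: eigenvalues_def)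
qed

text \<open>An eigenvector of \<open>P Q\<close> solves the generalised problem \<open>Q u = z P\<^sup>-\<^sup>1 u\<close> with both forms positive
  definite. Pairing it with \<open>u\<close> makes \<open>z\<close> a quotient of two positive numbers; the proof does
  this with the real and imaginary parts of \<open>u\<close>.\<close>

lemma eigenvalues_spd_product:
  assumes P: "P \<in> spd" and Q: "Q \<in> spd" and z: "z \<in> eigenvalues (P ** Q)"
  shows "z \<in> \<real> \<and> Re z > 0"
proof -
  obtain a b where ab: "a \<noteq> 0 \<or> b \<noteq> 0"
    and a: "(P ** Q) *v a = Re z *\<^sub>R a - Im z *\<^sub>R b"
    and b: "(P ** Q) *v b = Re z *\<^sub>R b + Im z *\<^sub>R a"
    using eigenvalues_real_form[OF z] by blast
  define U where "U = matrix_inv P"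
  have U: "U \<in> spd" and UP: "U ** P = mat 1"
    using P by (simp_all add: U_def spd_inverse matrix_inv_left spd_invertible)
  have Qx: "Q *v x = U *v ((P ** Q) *v x)" for x
    using arg_cong[OF UP, of "\<lambda>Z. Z *v (Q *v x)"] by (simp add: matrix_vector_mul_assoc[symmetric])
  have Qa: "Q *v a = Re z *\<^sub>R (U *v a) - Im z *\<^sub>R (U *v b)"
    unfolding Qx[of a] a by (simp add: matrix_vector_mult_diff_distrib matrix_vector_mult_scaleR)
  have Qb: "Q *v b = Re z *\<^sub>R (U *v b) + Im z *\<^sub>R (U *v a)"
    unfolding Qx[of b] b by (simp add: matrix_vector_right_distrib matrix_vector_mult_scaleR)
  have nonneg: "x \<bullet> (V *v x) \<ge> 0" if "V \<in> spd" for V and x :: "real^'a"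
    using spd_pos[OF that, of x] by (cases "x = 0") auto
  have Upos: "a \<bullet> (U *v a) + b \<bullet> (U *v b) > 0"
    using ab spd_pos[OF U] nonneg[OF U] by (metis add_nonneg_pos add_pos_nonneg)
  have Qpos: "a \<bullet> (Q *v a) + b \<bullet> (Q *v b) > 0"
    using ab spd_pos[OF Q] nonneg[OF Q] by (metis add_nonneg_pos add_pos_nonneg)
  have Uab: "b \<bullet> (U *v a) = a \<bullet> (U *v b)" using spd_inner[OF U] by (simp add: inner_commute)
  have "b \<bullet> (Q *v a) = a \<bullet> (Q *v b)" using spd_inner[OF Q] by (simp add: inner_commute)
  then have "Im z * (a \<bullet> (U *v a) + b \<bullet> (U *v b)) = 0"
    by (simp add: Qa Qb inner_diff_right inner_add_right Uab algebra_simps)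
  then have "Im z = 0" using Upos by simp
  moreover have "a \<bullet> (Q *v a) + b \<bullet> (Q *v b) = Re z * (a \<bullet> (U *v a) + b \<bullet> (U *v b))"
    using \<open>Im z = 0\<close> by (simp add: Qa Qb algebra_simps)
  ultimately show ?thesis using Upos Qpos by (simp add: complex_is_Real_iff zero_less_mult_iff)
qed

text \<open>With \<open>R = P\<^sup>1\<^sup>/\<^sup>2\<close>, the product \<open>P Q\<close> is similar to the positive definite \<open>R Q R\<close>.\<close>

lemma spd_product_span_eigenvectors:
  fixes P Q :: "real^'n^'n"
  assumes P: "P \<in> spd" and Q: "Q \<in> spd"
  shows "span {v. \<exists>r>0. (P ** Q) *v v = r *\<^sub>R v} = UNIV"
proof -
  define R where "R = spd_sqrt P"
  have R: "R \<in> spd" "R ** R = P" using P by (simp_all add: R_def spd_sqrt_spd spd_sqrt_square)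
  let ?E = "{v. \<exists>r>0. (R ** Q ** R) *v v = r *\<^sub>R v}"
  have "(*v) R ` ?E \<subseteq> {v. \<exists>r>0. (P ** Q) *v v = r *\<^sub>R v}"
  proof clarify
    fix v r assume r: "(r::real) > 0" "(R ** Q ** R) *v v = r *\<^sub>R v"
    have "(P ** Q) *v (R *v v) = R *v ((R ** Q ** R) *v v)"
      by (simp add: R(2) matrix_vector_mul_assoc matrix_mul_assoc)
    with r show "\<exists>r>0. (P ** Q) *v (R *v v) = r *\<^sub>R (R *v v)"
      by (auto simp: matrix_vector_mult_scaleR)
  qed
  then have "span ((*v) R ` ?E) \<subseteq> span {v. \<exists>r>0. (P ** Q) *v v = r *\<^sub>R v}" by (rule span_mono)
  moreover have "span ((*v) R ` ?E) = range ((*v) R)"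
    by (simp add: linear_span_image spd_span_eigenvectors spd_congruence_spd Q R)
  moreover have "range ((*v) R) = UNIV"
  proof -
    have "y = R *v (matrix_inv R *v y)" for y
      using R by (simp add: matrix_vector_mul_assoc matrix_inv_right spd_invertible)
    then show ?thesis by blast
  qed
  ultimately show ?thesis by blast
qed

text \<open>Among the possibly nonsymmetric roots, uniqueness follows from \<open>sylvester_zero\<close>: \<open>P Q\<close> is
  diagonalisable with positive eigenvalues, and a competing root has no negative eigenvalue.\<close>

lemma principal_sqrt_spd_product:
  assumes P: "P \<in> spd" and Q: "Q \<in> spd"
  shows "principal_sqrt ((P ** Q) ** (P ** Q)) = P ** Q"
  unfolding principal_sqrt_def
proof (rule the_equality)
  fix S assume S: "S ** S = (P ** Q) ** (P ** Q) \<and> (\<forall>z\<in>eigenvalues S. z \<in> \<real> \<and> Re z > 0)"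
  let ?T = "P ** Q"
  have eq: "S ** (S - ?T) + (S - ?T) ** ?T = 0"
    using S by (simp add: matrix_diff_ldistrib matrix_diff_rdistrib)
  have "u = 0" if "r > 0" "S *v u = - r *\<^sub>R u" for r u
  proof (rule ccontr)
    assume "u \<noteq> 0"
    with real_eigenvalue_in_eigenvalues[OF that(2)] S have "Re (complex_of_real (- r)) > 0" by blast
    with that show False by simp
  qed
  then have "{v. \<exists>r>0. ?T *v v = r *\<^sub>R v} \<subseteq>
      {v. \<exists>r. ?T *v v = r *\<^sub>R v \<and> (\<forall>u. S *v u = - r *\<^sub>R u \<longrightarrow> u = 0)}" by blast
  then have "span {v. \<exists>r. ?T *v v = r *\<^sub>R v \<and> (\<forall>u. S *v u = - r *\<^sub>R u \<longrightarrow> u = 0)} = UNIV"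
    using span_mono spd_product_span_eigenvectors[OF P Q] by blast
  with sylvester_zero[OF eq] show "S = ?T" by simp
qed (use eigenvalues_spd_product[OF P Q] in auto)

section \<open>Solving the matrix equation\<close>

text \<open>The symmetric matrices with spectrum in \<open>[a, b]\<close>, described by the quadratic form so that
  closedness and convexity are evident.\<close>

definition quad_between :: "real \<Rightarrow> real \<Rightarrow> (real^'n^'n) set" where
  "quad_between a b = {X. transpose X = X \<and>
     (\<forall>x. a * (norm x)\<^sup>2 \<le> x \<bullet> (X *v x) \<and> x \<bullet> (X *v x) \<le> b * (norm x)\<^sup>2)}"

lemma quad_between_spd:
  assumes "0 < a" "X \<in> quad_between a b"
  shows "X \<in> spd"
proof -
  have "x \<bullet> (X *v x) > 0" if "x \<noteq> 0" for x
  proof -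
    have "0 < a * (norm x)\<^sup>2" using assms(1) that by simp
    also have "\<dots> \<le> x \<bullet> (X *v x)" using assms(2) by (simp add: quad_between_def)
    finally show ?thesis .
  qed
  then show ?thesis using assms(2) by (simp add: quad_between_def spd_def)
qed

lemma quad_between_mono:
  assumes "a' \<le> a" "b \<le> b'" "X \<in> quad_between a b"
  shows "X \<in> quad_between a' b'"
proof -
  have "a' * (norm x)\<^sup>2 \<le> a * (norm x)\<^sup>2" "b * (norm x)\<^sup>2 \<le> b' * (norm x)\<^sup>2" for x :: "real^'a"
    using assms by (simp_all add: mult_right_mono)
  then show ?thesis using assms(3) by (auto simp: quad_between_def intro: order_trans)
qed

lemma quad_between_ordered:
  assumes "X \<in> quad_between a b"
  shows "a \<le> b"
proof -
  let ?e = "axis undefined 1 :: real^'a"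
  have "a * (norm ?e)\<^sup>2 \<le> b * (norm ?e)\<^sup>2"
    using assms unfolding quad_between_def by (blast intro: order_trans)
  then show ?thesis by simp
qed

lemma spd_in_quad_between:
  fixes V :: "real^'n^'n"
  assumes V: "V \<in> spd"
  obtains a b where "0 < a" "V \<in> quad_between a b"
proof -
  have UNIV: "(UNIV :: (real^'n) set) \<noteq> {0}"
    by (metis axis_eq_0_iff singletonD UNIV_I zero_neq_one)
  obtain v r where v: "norm v = 1" "V *v v = r *\<^sub>R v" and low: "\<And>x. r * (norm x)\<^sup>2 \<le> x \<bullet> (V *v x)"
    using symmetric_least_eigenvector[OF spd_symmetric[OF V] subspace_UNIV UNIV] by auto
  have "v \<noteq> 0" using v(1) by (metis norm_zero zero_neq_one)
  then have "r > 0" using spd_eigenvalue_pos[OF V v(2)] by simp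
  have "x \<bullet> (V *v x) \<le> onorm ((*v) V) * (norm x)\<^sup>2" for x
  proof -
    have "x \<bullet> (V *v x) \<le> norm x * norm (V *v x)" by (rule norm_cauchy_schwarz)
    also have "\<dots> \<le> norm x * (onorm ((*v) V) * norm x)"
      by (intro mult_left_mono onorm) (auto intro: matrix_vector_mul_bounded_linear)
    finally show ?thesis by (simp add: power2_eq_square mult_ac)
  qed
  with low that[OF \<open>r > 0\<close>] spd_symmetric[OF V] show thesis by (auto simp: quad_between_def)
qed

lemma continuous_on_matrix_vector_left: "continuous_on A (\<lambda>X::real^'n^'m. X *v x)"
  unfolding matrix_vector_mult_def by (intro continuous_intros)

lemma continuous_on_matrix_mult:
  fixes f :: "'a::topological_space \<Rightarrow> real^'n^'m" and g :: "'a \<Rightarrow> real^'k^'n"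
  assumes "continuous_on A f" "continuous_on A g"
  shows "continuous_on A (\<lambda>x. f x ** g x)"
  unfolding matrix_matrix_mult_def using assms by (intro continuous_intros)

text \<open>For boundedness, polarisation bounds the entries of a semidefinite matrix by its values on
  sums and differences of unit vectors.\<close>

lemma compact_quad_between:
  assumes "0 \<le> a"
  shows "compact (quad_between a b :: (real^'n^'n) set)"
proof -
  let ?K = "quad_between a b :: (real^'n^'n) set"
  have eq: "?K = (\<Inter>x y. {X. x \<bullet> (X *v y) = (X *v x) \<bullet> y}) \<inter>
      (\<Inter>x. {X. a * (norm x)\<^sup>2 \<le> x \<bullet> (X *v x)} \<inter> {X. x \<bullet> (X *v x) \<le> b * (norm x)\<^sup>2})"
    unfolding quad_between_def symmetric_matrix_iff by blast
  have "closed ?K"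
    unfolding eq
    by (intro closed_Int closed_INT ballI closed_Collect_eq closed_Collect_le
        continuous_intros continuous_on_matrix_vector_left)
  moreover have "bounded ?K"
  proof (rule boundedI)
    fix X assume X: "X \<in> ?K"
    have b: "b \<ge> 0" using quad_between_ordered[OF X] assms by simp
    have psd: "0 \<le> x \<bullet> (X *v x)" for x
      using X assms by (auto simp: quad_between_def intro: order_trans[rotated])
    have up: "x \<bullet> (X *v x) \<le> 4 * b" if "norm x \<le> 2" for x
    proof -
      have "x \<bullet> (X *v x) \<le> b * (norm x)\<^sup>2" using X by (simp add: quad_between_def)
      also have "\<dots> \<le> b * 2\<^sup>2" using that b by (intro mult_left_mono power_mono) auto
      finally show ?thesis by simp
    qed
    have entry: "\<bar>X $ i $ j\<bar> \<le> b" for i j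
    proof -
      let ?p = "axis i 1 + axis j 1 :: real^'n" and ?m = "axis i 1 - axis j 1 :: real^'n"
      have "norm ?p \<le> 2" "norm ?m \<le> 2"
        using norm_triangle_ineq[of "axis i 1 :: real^'n" "axis j 1"]
          norm_triangle_ineq4[of "axis i 1 :: real^'n" "axis j 1"] by auto
      moreover have "axis j 1 \<bullet> (X *v axis i 1) = axis i 1 \<bullet> (X *v axis j 1)"
        using X by (simp only: quad_between_def symmetric_matrix_iff mem_Collect_eq inner_commute)
      then have "?p \<bullet> (X *v ?p) - ?m \<bullet> (X *v ?m) = 4 * (axis i 1 \<bullet> (X *v axis j 1))"
        by (simp add: matrix_vector_right_distrib matrix_vector_mult_diff_distrib
            inner_add_left inner_add_right inner_diff_left inner_diff_right)
      moreover have "axis i 1 \<bullet> (X *v axis j 1) = X $ i $ j"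
        by (simp add: inner_axis' matrix_vector_mult_basis column_def)
      ultimately show ?thesis using psd[of ?p] psd[of ?m] up[of ?p] up[of ?m] by linarith
    qed
    have "norm X \<le> (\<Sum>i\<in>UNIV. norm (X $ i))" by (simp add: norm_vec_def L2_set_le_sum)
    also have "\<dots> \<le> (\<Sum>i\<in>(UNIV::'n set). \<Sum>j\<in>(UNIV::'n set). b)"
      by (intro sum_mono order_trans[OF norm_le_l1_cart] entry)
    finally show "norm X \<le> (\<Sum>i\<in>(UNIV::'n set). \<Sum>j\<in>(UNIV::'n set). b)" .
  qed
  ultimately show ?thesis by (simp add: compact_eq_bounded_closed)
qed

lemma convex_quad_between: "convex (quad_between a b)"
proof (rule convexI)
  fix X Y :: "real^'n^'n" and u v :: real
  assume X: "X \<in> quad_between a b" and Y: "Y \<in> quad_between a b" and uv: "0 \<le> u" "0 \<le> v" "u + v = 1"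
  let ?Z = "u *\<^sub>R X + v *\<^sub>R Y"
  have Z: "x \<bullet> (?Z *v y) = u * (x \<bullet> (X *v y)) + v * (x \<bullet> (Y *v y))" for x y
    by (simp add: matrix_vector_mult_add_rdistrib scaleR_matrix_vector_assoc[symmetric] inner_add_right)
  have "transpose ?Z = ?Z"
    using X Y by (simp add: quad_between_def vec_eq_iff transpose_def)
  moreover have "a * (norm x)\<^sup>2 \<le> x \<bullet> (?Z *v x) \<and> x \<bullet> (?Z *v x) \<le> b * (norm x)\<^sup>2" for x
  proof -
    have split: "t = u * t + v * t" for t
      using uv(3) by (simp only: distrib_right[symmetric] mult_1_left)
    have "u * (a * (norm x)\<^sup>2) + v * (a * (norm x)\<^sup>2) \<le> x \<bullet> (?Z *v x)"
      "x \<bullet> (?Z *v x) \<le> u * (b * (norm x)\<^sup>2) + v * (b * (norm x)\<^sup>2)"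
      unfolding Z using X Y uv by (auto simp: quad_between_def intro!: add_mono mult_left_mono)
    then show ?thesis by (simp only: split[symmetric])
  qed
  ultimately show "?Z \<in> quad_between a b" by (simp add: quad_between_def)
qed

text \<open>The upper bound is Cauchy-Schwarz with \<open>|S x|\<^sup>2 = \<langle>x, V x\<rangle>\<close>, where \<open>S\<close> is the root; the lower bound
  is read off at an eigenvector for the least eigenvalue of \<open>S\<close>.\<close>

lemma spd_sqrt_quad_between:
  fixes V :: "real^'n^'n"
  assumes ab: "0 < a" "0 < b" and V: "V \<in> quad_between (a\<^sup>2) (b\<^sup>2)"
  shows "spd_sqrt V \<in> quad_between a b"
proof -
  define S where "S = spd_sqrt V"
  have spd: "V \<in> spd" using quad_between_spd[OF _ V] ab by simp
  have S: "S \<in> spd" "S ** S = V" using spd by (simp_all add: S_def spd_sqrt_spd spd_sqrt_square)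
  have quad: "x \<bullet> (V *v x) = (norm (S *v x))\<^sup>2" for x
    by (simp only: S(2)[symmetric] matrix_vector_mul_assoc[symmetric] spd_inner[OF S(1)] power2_norm_eq_inner)
  have V': "a\<^sup>2 * (norm x)\<^sup>2 \<le> x \<bullet> (V *v x)" "x \<bullet> (V *v x) \<le> b\<^sup>2 * (norm x)\<^sup>2" for x
    using V by (simp_all add: quad_between_def)
  have UNIV: "(UNIV :: (real^'n) set) \<noteq> {0}"
    by (metis axis_eq_0_iff singletonD UNIV_I zero_neq_one)
  obtain v r where v: "norm v = 1" "S *v v = r *\<^sub>R v" and low: "\<And>x. r * (norm x)\<^sup>2 \<le> x \<bullet> (S *v x)"
    using symmetric_least_eigenvector[OF spd_symmetric[OF S(1)] subspace_UNIV UNIV] by auto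
  have "v \<noteq> 0" using v(1) by (metis norm_zero zero_neq_one)
  then have "r > 0" using spd_eigenvalue_pos[OF S(1) v(2)] by simp
  have "a\<^sup>2 \<le> r\<^sup>2" using V'(1)[of v] by (simp add: quad v power_mult_distrib)
  then have "a \<le> r" using \<open>r > 0\<close> power2_le_imp_le by fastforce
  have "a * (norm x)\<^sup>2 \<le> x \<bullet> (S *v x)" for x
  proof -
    have "a * (norm x)\<^sup>2 \<le> r * (norm x)\<^sup>2" using \<open>a \<le> r\<close> by (simp add: mult_right_mono)
    then show ?thesis using low[of x] by linarith
  qed
  moreover have "x \<bullet> (S *v x) \<le> b * (norm x)\<^sup>2" for x
  proof -
    have "(norm (S *v x))\<^sup>2 \<le> (b * norm x)\<^sup>2" using V'(2)[of x] by (simp add: quad power_mult_distrib)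
    then have "norm (S *v x) \<le> b * norm x" by (rule power2_le_imp_le) (use ab in simp)
    then have "norm x * norm (S *v x) \<le> norm x * (b * norm x)" by (rule mult_left_mono) simp
    also have "norm x * (b * norm x) = b * (norm x)\<^sup>2" by (simp only: power2_eq_square mult_ac)
    finally show ?thesis using norm_cauchy_schwarz[of x "S *v x"] by linarith
  qed
  ultimately show ?thesis using spd_symmetric[OF S(1)] by (simp add: quad_between_def S_def[symmetric])
qed

text \<open>Squaring is continuous and injective on a compact set of positive definite matrices, so its
  inverse is continuous on the image.\<close>

lemma continuous_on_spd_sqrt:
  assumes ab: "0 < a" "0 < b"
  shows "continuous_on (quad_between (a\<^sup>2) (b\<^sup>2) :: (real^'a^'a) set) spd_sqrt"
proof -
  have "continuous_on ((\<lambda>S. S ** S) ` (quad_between a b :: (real^'a^'a) set)) spd_sqrt"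
  proof (rule continuous_on_inv)
    show "compact (quad_between a b :: (real^'a^'a) set)" using ab by (simp add: compact_quad_between)
    show "\<forall>S\<in>quad_between a b. spd_sqrt (S ** S) = S"
      using quad_between_spd[OF ab(1)] spd_sqrt_unique by blast
  qed (intro continuous_on_matrix_mult continuous_intros)
  moreover have "quad_between (a\<^sup>2) (b\<^sup>2) \<subseteq> (\<lambda>S. S ** S) ` (quad_between a b :: (real^'a^'a) set)"
  proof
    fix V :: "real^'a^'a" assume V: "V \<in> quad_between (a\<^sup>2) (b\<^sup>2)"
    then have "spd_sqrt V ** spd_sqrt V = V"
      using quad_between_spd[OF _ V] ab by (simp add: spd_sqrt_square)
    then show "V \<in> (\<lambda>S. S ** S) ` quad_between a b"
      by (intro image_eqI[OF sym]) (use spd_sqrt_quad_between[OF ab V] in simp_all)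
  qed
  ultimately show ?thesis using continuous_on_subset by blast
qed

text \<open>Estimate the form of \<open>V\<close> at \<open>X\<^sup>1\<^sup>/\<^sup>2 x\<close> first and then \<open>|X\<^sup>1\<^sup>/\<^sup>2 x|\<^sup>2 = \<langle>x, X x\<rangle>\<close>. Since a square root leads back
  to \<open>quad_between a b\<close>, this set is invariant under the right-hand side of the matrix equation.\<close>

lemma quad_between_sandwich:
  assumes ab: "0 < a" and V: "V \<in> quad_between a b" and X: "X \<in> quad_between a b"
  shows "spd_sqrt X ** V ** spd_sqrt X \<in> quad_between (a\<^sup>2) (b\<^sup>2)"
proof -
  define R where "R = spd_sqrt X"
  have spd: "V \<in> spd" "X \<in> spd" by (rule quad_between_spd[OF ab V], rule quad_between_spd[OF ab X])
  then have R: "R \<in> spd" "R ** R = X" by (simp_all add: R_def spd_sqrt_spd spd_sqrt_square)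
  have "0 < b" using quad_between_ordered[OF V] ab by simp
  have quad: "x \<bullet> ((R ** V ** R) *v x) = (R *v x) \<bullet> (V *v (R *v x))" for x
    by (simp only: matrix_vector_mul_assoc[symmetric] spd_inner[OF R(1)])
  have norm: "(norm (R *v x))\<^sup>2 = x \<bullet> (X *v x)" for x
    by (simp only: R(2)[symmetric] matrix_vector_mul_assoc[symmetric] spd_inner[OF R(1)] power2_norm_eq_inner)
  have "a\<^sup>2 * (norm x)\<^sup>2 \<le> x \<bullet> ((R ** V ** R) *v x)" for x
  proof -
    have "a * (a * (norm x)\<^sup>2) \<le> a * (norm (R *v x))\<^sup>2"
      unfolding norm using X ab by (intro mult_left_mono) (auto simp: quad_between_def)
    also have "\<dots> \<le> (R *v x) \<bullet> (V *v (R *v x))" using V by (simp add: quad_between_def)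
    finally show ?thesis by (simp add: quad power2_eq_square mult_ac)
  qed
  moreover have "x \<bullet> ((R ** V ** R) *v x) \<le> b\<^sup>2 * (norm x)\<^sup>2" for x
  proof -
    have "(R *v x) \<bullet> (V *v (R *v x)) \<le> b * (norm (R *v x))\<^sup>2" using V by (simp add: quad_between_def)
    also have "\<dots> \<le> b * (b * (norm x)\<^sup>2)"
      unfolding norm using X \<open>0 < b\<close> by (intro mult_left_mono) (auto simp: quad_between_def)
    finally show ?thesis by (simp add: quad power2_eq_square mult_ac)
  qed
  ultimately show ?thesis
    using spd_symmetric[OF spd_congruence_spd[OF spd(1) R(1)]] by (simp add: quad_between_def R_def[symmetric])
qed

text \<open>Brouwer's theorem on \<open>quad_between a b\<close>, where \<open>[a, b]\<close> contains the spectra of all \<open>A i\<close>.\<close>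

theorem barycenter_equation_solvable:
  fixes A :: "'i \<Rightarrow> real^'n^'n"
  assumes I: "finite I" and w: "\<And>i. i \<in> I \<Longrightarrow> 0 \<le> w i" "(\<Sum>i\<in>I. w i) = 1"
    and A: "\<And>i. i \<in> I \<Longrightarrow> A i \<in> spd"
  obtains X where "X \<in> spd" "X = (\<Sum>i\<in>I. w i *\<^sub>R spd_sqrt (spd_sqrt X ** A i ** spd_sqrt X))"
proof -
  have "I \<noteq> {}" using w(2) by auto
  have "\<exists>a b. 0 < a \<and> A i \<in> quad_between a b" if "i \<in> I" for i
    using spd_in_quad_between[OF A[OF that]] by blast
  then obtain f g where fg: "\<And>i. i \<in> I \<Longrightarrow> 0 < f i" "\<And>i. i \<in> I \<Longrightarrow> A i \<in> quad_between (f i) (g i)"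
    by metis
  define a b where "a = Min (f ` I)" and "b = Max (g ` I)"
  have AI: "A i \<in> quad_between a b" if "i \<in> I" for i
    using quad_between_mono[OF _ _ fg(2)[OF that]] I that by (simp add: a_def b_def)
  have a: "0 < a" using I \<open>I \<noteq> {}\<close> fg(1) by (simp add: a_def)
  obtain i0 where "i0 \<in> I" using \<open>I \<noteq> {}\<close> by blast
  then have b: "0 < b" using quad_between_ordered[OF AI] a by fastforce
  let ?K = "quad_between a b :: (real^'n^'n) set"
  let ?F = "\<lambda>X. \<Sum>i\<in>I. w i *\<^sub>R spd_sqrt (spd_sqrt X ** A i ** spd_sqrt X)"
  have "continuous_on ?K spd_sqrt"
    using continuous_on_spd_sqrt[of "sqrt a" "sqrt b"] a b by simp
  then have "continuous_on ?K (\<lambda>X. spd_sqrt (spd_sqrt X ** A i ** spd_sqrt X))" if "i \<in> I" for i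
    using quad_between_sandwich[OF a AI[OF that]]
    by (intro continuous_on_compose2[OF continuous_on_spd_sqrt[OF a b],
          of ?K "\<lambda>X. spd_sqrt X ** A i ** spd_sqrt X"]
        continuous_on_matrix_mult[of ?K] continuous_on_const) auto
  then have "continuous_on ?K ?F" by (intro continuous_on_sum continuous_on_scaleR continuous_on_const)
  moreover have "?F \<in> ?K \<rightarrow> ?K"
  proof
    fix X assume X: "X \<in> ?K"
    show "?F X \<in> ?K"
      using w AI I by (intro convex_sum convex_quad_between spd_sqrt_quad_between[OF a b]
          quad_between_sandwich[OF a _ X]) auto
  qed
  moreover have "compact ?K" "convex ?K" "?K \<noteq> {}"
    using a AI \<open>I \<noteq> {}\<close> by (auto simp: compact_quad_between convex_quad_between)
  ultimately obtain X where "X \<in> ?K" "?F X = X" using brouwer[of ?K ?F] by blast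
  then show thesis by (intro that[OF quad_between_spd[OF a] sym])
qed

section \<open>Measurability of the deformed exponential\<close>

lemma phi_class_regular:
  assumes "\<phi> \<in> phi_class a"
  shows "continuous_on {0<..} \<phi>" "\<And>s. s > 0 \<Longrightarrow> \<phi> s > 0"
  using assms by (auto simp: phi_class_def)

lemma ln_phi_has_derivative:
  assumes \<phi>: "continuous_on {0<..} \<phi>" "\<And>s. s > 0 \<Longrightarrow> \<phi> s > 0" and t: "0 < t"
  shows "(ln_phi \<phi> has_real_derivative 1 / \<phi> t) (at t)"
proof -
  \<comment> \<open>An interval inside \<open>(0, \<infinity>)\<close> with the base point \<open>1\<close> and \<open>t\<close> in its interior.\<close>
  define a b where "a = min 1 t / 2" and "b = max 1 t + 1"
  have ab: "0 < a" "a < 1" "1 < b" "a < t" "t < b" using t by (auto simp: a_def b_def)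
  have "continuous_on {a..b} (\<lambda>s. 1 / \<phi> s)"
  proof (intro continuous_intros ballI)
    show "continuous_on {a..b} \<phi>" using \<phi>(1) by (rule continuous_on_subset) (use ab in auto)
    show "\<phi> s \<noteq> 0" if "s \<in> {a..b}" for s using \<phi>(2)[of s] that ab by auto
  qed
  then have "((\<lambda>u. LBINT s=1..u. 1 / \<phi> s) has_vector_derivative 1 / \<phi> t) (at t within {a..b})"
    using interval_integral_FTC2[of a 1 b "\<lambda>s. 1 / \<phi> s" t] ab by (simp add: one_ereal_def)
  moreover have "at t within {a..b} = at t" using ab by (simp add: at_within_Icc_at)
  moreover have "ln_phi \<phi> = (\<lambda>u. LBINT s=1..u. 1 / \<phi> s)" by (simp add: fun_eq_iff ln_phi_def)
  ultimately show ?thesis by (simp add: has_real_derivative_iff_has_vector_derivative)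
qed

lemma ln_phi_strict_mono:
  assumes \<phi>: "continuous_on {0<..} \<phi>" "\<And>s. s > 0 \<Longrightarrow> \<phi> s > 0"
  shows "strict_mono_on {0<..} (ln_phi \<phi>)"
proof (rule strict_mono_onI)
  fix s t :: real assume "s \<in> {0<..}" "t \<in> {0<..}" "s < t"
  then have "\<exists>D. (ln_phi \<phi> has_real_derivative D) (at x) \<and> D > 0" if "s \<le> x" "x \<le> t" for x
    using ln_phi_has_derivative[of \<phi> x] \<phi> that by (intro exI[of _ "1 / \<phi> x"]) simp
  with \<open>s < t\<close> show "ln_phi \<phi> s < ln_phi \<phi> t" by (rule DERIV_pos_imp_increasing)
qed

lemma ln_phi_attains:
  assumes \<phi>: "continuous_on {0<..} \<phi>" "\<And>s. s > 0 \<Longrightarrow> \<phi> s > 0"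
    and s: "l_phi \<phi> < ereal s" "ereal s < L_phi \<phi>"
  obtains t where "0 < t" "ln_phi \<phi> t = s"
proof -
  obtain p where p: "0 < p" "ln_phi \<phi> p < s" using s(1) by (auto simp: l_phi_def INF_less_iff)
  obtain q where q: "0 < q" "s < ln_phi \<phi> q" using s(2) by (auto simp: L_phi_def less_SUP_iff)
  have "p \<le> q"
  proof (rule ccontr)
    assume "\<not> p \<le> q"
    then have "ln_phi \<phi> q < ln_phi \<phi> p"
      using ln_phi_strict_mono[OF \<phi>] p q by (simp add: strict_mono_on_def)
    with p q show False by simp
  qed
  moreover have "continuous_on {p..q} (ln_phi \<phi>)"
    using p(1)
    by (intro continuous_at_imp_continuous_on ballI DERIV_isCont[OF ln_phi_has_derivative[OF \<phi>]]) auto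
  ultimately obtain t where "p \<le> t" "ln_phi \<phi> t = s"
    using IVT'[of "ln_phi \<phi>" p s q] p q by auto
  then show thesis using that[of t] p by simp
qed

text \<open>Monotone functions are Borel measurable; this is how the densities become measurable.\<close>

lemma mono_exp_phi:
  assumes \<phi>: "continuous_on {0<..} \<phi>" "\<And>s. s > 0 \<Longrightarrow> \<phi> s > 0"
  shows "mono (exp_phi \<phi>)"
proof (rule monoI)
  fix s t :: real assume "s \<le> t"
  consider "ereal s \<le> l_phi \<phi>" | "L_phi \<phi> \<le> ereal t" "l_phi \<phi> < ereal t"
    | "l_phi \<phi> < ereal s" "ereal t < L_phi \<phi>"
    using \<open>s \<le> t\<close> by (metis ereal_less_eq(3) leI order_trans not_le)
  then show "exp_phi \<phi> s \<le> exp_phi \<phi> t"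
  proof cases
    case 3
    then have st: "l_phi \<phi> < ereal t" "ereal s < L_phi \<phi>"
      using \<open>s \<le> t\<close> less_le_trans[of "l_phi \<phi>" "ereal s" "ereal t"]
        le_less_trans[of "ereal s" "ereal t" "L_phi \<phi>"] by simp_all
    obtain p where p: "0 < p" "ln_phi \<phi> p = s" using ln_phi_attains[OF \<phi> 3(1) st(2)] .
    obtain q where q: "0 < q" "ln_phi \<phi> q = t" using ln_phi_attains[OF \<phi> st(1) 3(2)] .
    have mono: "strict_mono_on {0<..} (ln_phi \<phi>)" by (rule ln_phi_strict_mono[OF \<phi>])
    then have inj: "inj_on (ln_phi \<phi>) {0<..}" by (rule strict_mono_on_imp_inj_on)
    have "\<not> q < p"
    proof
      assume "q < p"
      then have "t < s" using mono p q by (auto simp: strict_mono_on_def)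
      with \<open>s \<le> t\<close> show False by simp
    qed
    moreover have "exp_phi \<phi> s = ennreal p" "exp_phi \<phi> t = ennreal q"
      using 3 st p q the_inv_into_f_f[OF inj, of p] the_inv_into_f_f[OF inj, of q]
      by (auto simp: exp_phi_def)
    ultimately show ?thesis by (simp add: ennreal_leI)
  qed (auto simp: exp_phi_def)
qed

lemma borel_measurable_mono_ennreal:
  fixes f :: "real \<Rightarrow> ennreal"
  assumes "mono f"
  shows "f \<in> borel_measurable borel"
proof (rule borel_measurableI_greater)
  fix y
  have "is_interval {x. y < f x}"
    unfolding is_interval_1 using monoD[OF assms] by (auto intro: less_le_trans)
  then show "{x \<in> space borel. y < f x} \<in> sets borel" by (simp add: real_interval_borel_measurable)
qed

lemma borel_measurable_exp_phi_quadratic: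
  fixes V :: "real^'n^'n"
  assumes "\<phi> \<in> phi_class a"
  shows "(\<lambda>x. exp_phi \<phi> (l - c * ((x - v) \<bullet> (V *v (x - v))))) \<in> borel_measurable borel"
proof (rule measurable_compose[OF _ borel_measurable_mono_ennreal[OF mono_exp_phi]])
  show "(\<lambda>x. l - c * ((x - v) \<bullet> (V *v (x - v)))) \<in> borel_measurable borel"
    by (intro borel_measurable_continuous_onI continuous_intros
        continuous_on_compose2[OF matrix_vector_mult_linear_continuous_on]) auto
qed (use phi_class_regular[OF assms] in auto)

section \<open>Linear images of Lebesgue measure\<close>

lemma lborel_emeasure_ball_translate:
  fixes x :: "'a::euclidean_space"
  shows "emeasure lborel (ball x r) = emeasure lborel (ball (0::'a) r)"
proof -
  have "emeasure lborel (ball x r) = emeasure (distr lborel borel ((+) x)) (ball x r)"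
    by (simp add: lborel_distr_plus)
  also have "\<dots> = emeasure lborel ((+) x -` ball x r \<inter> space lborel)"
    by (rule emeasure_distr) auto
  also have "(+) x -` ball x r \<inter> space lborel = ball 0 r"
    by (auto simp: dist_norm)
  finally show ?thesis .
qed

text \<open>Uniqueness of Haar measure by Fubini: with \<open>D\<close> the unit ball, both sides of
  \<open>M(D) \<lambda>(B) = \<lambda>(D) M(B)\<close> are the double integral of \<open>1\<^sub>D(x) 1\<^sub>B(x + y)\<close>. Integrating over \<open>y\<close> first
  gives the left side. Replacing \<open>x\<close> by \<open>x - y\<close> and then integrating over \<open>y\<close> first gives the right
  side, as \<open>D\<close> is symmetric.\<close>

lemma translation_invariant_proportional_lborel:
  fixes M :: "'a::euclidean_space measure"
  assumes sf: "sigma_finite_measure M" and sets: "sets M = sets borel"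
    and inv: "\<And>x. distr M borel ((+) x) = M"
  shows "\<exists>k. M = density lborel (\<lambda>_. k)"
proof -
  let ?D = "ball (0::'a) 1"
  interpret M: sigma_finite_measure M by (rule sf)
  interpret P: pair_sigma_finite M lborel
    by (intro pair_sigma_finite.intro sf sigma_finite_lborel)
  have space: "space M = UNIV" using sets_eq_imp_space_eq[OF sets] by simp
  note [measurable_cong] = sets
  have DM: "?D \<in> sets M" by (simp add: sets)
  have [measurable]: "?D \<in> sets borel" by simp
  have [measurable]: "fst \<in> M \<Otimes>\<^sub>M lborel \<rightarrow>\<^sub>M borel" "snd \<in> M \<Otimes>\<^sub>M lborel \<rightarrow>\<^sub>M borel"
    using measurable_fst[of M lborel] measurable_snd[of M lborel]
    by (simp_all add: measurable_cong_sets[OF refl sets] cong: measurable_cong_sets)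
  have key: "emeasure M ?D * emeasure lborel B = emeasure lborel ?D * emeasure M B"
    if [measurable]: "B \<in> sets borel" for B
  proof -
    have trans_M: "(\<integral>\<^sup>+x. h (y + x) \<partial>M) = (\<integral>\<^sup>+x. h x \<partial>M)" if [measurable]: "h \<in> borel_measurable borel"
      for h and y :: 'a
      by (subst (2) inv[of y, symmetric], subst nn_integral_distr) (auto simp: sets)
    have trans_l: "(\<integral>\<^sup>+x. h (y + x) \<partial>lborel) = (\<integral>\<^sup>+x. h x \<partial>lborel)" if [measurable]: "h \<in> borel_measurable borel"
      for h and y :: 'a
      by (subst (2) lborel_distr_plus[of y, symmetric], subst nn_integral_distr) auto
    have "emeasure M ?D * emeasure lborel B
        = (\<integral>\<^sup>+x. indicator ?D x * (\<integral>\<^sup>+y. indicator B (x + y) \<partial>lborel) \<partial>M)"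
      by (simp only: trans_l borel_measurable_indicator that nn_integral_indicator sets_lborel
          nn_integral_multc[OF borel_measurable_indicator[OF DM]] nn_integral_indicator[OF DM])
    also have "\<dots> = (\<integral>\<^sup>+x. (\<integral>\<^sup>+y. indicator ?D x * indicator B (x + y) \<partial>lborel) \<partial>M)"
      by (simp add: nn_integral_cmult)
    also have "\<dots> = (\<integral>\<^sup>+y. (\<integral>\<^sup>+x. indicator ?D x * indicator B (x + y) \<partial>M) \<partial>lborel)"
      by (rule P.Fubini'[symmetric]) measurable
    also have "\<dots> = (\<integral>\<^sup>+y. (\<integral>\<^sup>+x. indicator ?D (x - y) * indicator B x \<partial>M) \<partial>lborel)"
    proof (rule nn_integral_cong)
      fix y :: 'a
      have "(\<integral>\<^sup>+x. indicator ?D (x - y) * indicator B x \<partial>M)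
          = (\<integral>\<^sup>+x. indicator ?D ((y + x) - y) * indicator B (y + x) \<partial>M)"
        by (rule trans_M[symmetric, where h = "\<lambda>x. indicator ?D (x - y) * indicator B x"]) measurable
      then show "(\<integral>\<^sup>+x. indicator ?D x * indicator B (x + y) \<partial>M)
          = (\<integral>\<^sup>+x. indicator ?D (x - y) * indicator B x \<partial>M)"
        by (simp add: add.commute)
    qed
    also have "\<dots> = (\<integral>\<^sup>+x. (\<integral>\<^sup>+y. indicator ?D (x - y) * indicator B x \<partial>lborel) \<partial>M)"
      by (rule P.Fubini') measurable
    also have "\<dots> = (\<integral>\<^sup>+x. emeasure lborel ?D * indicator B x \<partial>M)"
    proof (rule nn_integral_cong)
      fix x :: 'a
      have "(\<integral>\<^sup>+y. indicator ?D (x - y) \<partial>lborel) = (\<integral>\<^sup>+y. indicator (ball x 1) y \<partial>lborel)"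
        by (intro nn_integral_cong) (simp add: indicator_def dist_norm, metis norm_minus_commute)
      also have "\<dots> = emeasure lborel (ball x 1)" by simp
      also have "\<dots> = emeasure lborel ?D" by (rule lborel_emeasure_ball_translate)
      finally show "(\<integral>\<^sup>+y. indicator ?D (x - y) * indicator B x \<partial>lborel) = emeasure lborel ?D * indicator B x"
        by (simp add: nn_integral_multc)
    qed
    also have "\<dots> = emeasure lborel ?D * emeasure M B"
      using that by (subst nn_integral_cmult_indicator) (simp_all add: sets)
    finally show ?thesis .
  qed
  define d where "d = emeasure lborel ?D"
  have d: "d \<noteq> 0" "d < \<top>"
    unfolding d_def using emeasure_lborel_ball_finite[of 0 1]
    by (simp_all add: emeasure_ball order.strict_implies_not_eq[OF unit_ball_vol_pos, symmetric])
  have "M = density lborel (\<lambda>_. emeasure M ?D / d)"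
  proof (rule measure_eqI)
    fix B assume "B \<in> sets M"
    then have B: "B \<in> sets borel" by (simp add: sets)
    have "emeasure M B = d * emeasure M B / d"
      using d ennreal_mult_divide_eq[of d "emeasure M B"] by (simp add: mult.commute)
    also have "\<dots> = emeasure M ?D * emeasure lborel B / d" using key[OF B] by (simp add: d_def)
    also have "\<dots> = emeasure (density lborel (\<lambda>_. emeasure M ?D / d)) B"
      using B by (simp add: emeasure_density nn_integral_cmult_indicator)
        (simp only: divide_ennreal_def mult_ac)
    finally show "emeasure M B = emeasure (density lborel (\<lambda>_. emeasure M ?D / d)) B" .
  qed (simp add: sets)
  then show ?thesis by blast
qed

lemma measurable_matrix_vector_mult [measurable]: "(*v) T \<in> borel_measurable borel"
  for T :: "real^'n^'m"
  by (intro borel_measurable_continuous_onI continuous_intros)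

text \<open>The factor \<open>k\<close> is \<open>1 / |det T|\<close>; in \<open>distr_G_phi_matrix\<close> it is fixed by comparing total masses.\<close>

lemma distr_lborel_matrix:
  fixes T :: "real^'n^'n"
  assumes T: "invertible T"
  shows "\<exists>k. distr lborel borel ((*v) T) = density lborel (\<lambda>_. k)"
proof (rule translation_invariant_proportional_lborel)
  let ?U = "matrix_inv T" and ?M = "distr lborel borel ((*v) T)"
  have UT: "?U *v (T *v x) = x" "T *v (?U *v x) = x" for x
    using T by (simp_all add: matrix_vector_mul_assoc matrix_inv_left matrix_inv_right)
  have "distr ?M borel ((*v) ?U) = lborel"
    by (simp add: distr_distr o_def UT distr_id2)
  then show "sigma_finite_measure ?M"
    by (intro sigma_finite_measure_distr[of ?M borel "(*v) ?U"]) (simp_all add: sigma_finite_lborel)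
  fix x
  have "distr ?M borel ((+) x) = distr lborel borel (\<lambda>y. T *v (?U *v x + y))"
    by (simp add: distr_distr o_def matrix_vector_right_distrib UT)
  also have "\<dots> = distr (distr lborel borel ((+) (?U *v x))) borel ((*v) T)"
    by (simp add: distr_distr o_def)
  finally show "distr ?M borel ((+) x) = ?M" by (simp add: lborel_distr_plus)
qed simp

section \<open>Linear images of deformed exponential measures\<close>

lemma matrix_inv_congruence_form:
  fixes T X :: "real^'n^'n"
  assumes T: "invertible T" and X: "invertible X"
  shows "(T *v x) \<bullet> (matrix_inv (T ** X ** transpose T) *v (T *v x)) = x \<bullet> (matrix_inv X *v x)"
proof -
  let ?U = "matrix_inv T"
  have UT: "?U ** T = mat 1" "T ** ?U = mat 1" using T by (simp_all add: matrix_inv_left matrix_inv_right)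
  have tUT: "transpose T ** transpose ?U = mat 1"
    by (simp only: matrix_transpose_mul[symmetric] UT transpose_mat)
  have "(T ** X ** transpose T) ** (transpose ?U ** matrix_inv X ** ?U)
      = T ** (X ** ((transpose T ** transpose ?U) ** matrix_inv X)) ** ?U"
    by (simp only: matrix_mul_assoc)
  also have "\<dots> = mat 1" using X by (simp add: tUT matrix_inv_right UT)
  finally have inv: "matrix_inv (T ** X ** transpose T) = transpose ?U ** matrix_inv X ** ?U"
    by (rule matrix_inv_unique)
  have "(transpose ?U ** matrix_inv X ** ?U) *v (T *v x) = transpose ?U *v (matrix_inv X *v ((?U ** T) *v x))"
    by (simp only: matrix_vector_mul_assoc matrix_mul_assoc)
  then have "matrix_inv (T ** X ** transpose T) *v (T *v x) = transpose ?U *v (matrix_inv X *v x)"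
    by (simp only: inv UT matrix_vector_mul_lid)
  then have "(T *v x) \<bullet> (matrix_inv (T ** X ** transpose T) *v (T *v x))
      = (?U *v (T *v x)) \<bullet> (matrix_inv X *v x)"
    by (simp only: inner_matrix_vector_transpose[of _ "transpose ?U"] transpose_transpose)
  then show ?thesis by (simp add: matrix_vector_mul_assoc UT)
qed

text \<open>Both constants are the reciprocal of the integral of \<open>h\<close>, which is neither zero nor infinite
  since its multiple by \<open>p\<close> is one.\<close>

lemma density_proportional_prob_eq:
  fixes h :: "'a \<Rightarrow> ennreal"
  assumes [measurable]: "h \<in> borel_measurable M"
    and p: "prob_space (density M (\<lambda>x. p * h x))" and q: "prob_space (density M (\<lambda>x. q * h x))"
  shows "density M (\<lambda>x. p * h x) = density M (\<lambda>x. q * h x)"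
proof -
  let ?J = "\<integral>\<^sup>+x. h x \<partial>M"
  have "r * ?J = 1" if "prob_space (density M (\<lambda>x. r * h x))" for r
    using prob_space.emeasure_space_1[OF that]
    by (simp add: emeasure_density nn_integral_cmult cong: nn_integral_cong)
  then have pq: "p * ?J = 1" "q * ?J = 1" using p q by blast+
  then have "?J \<noteq> 0" "?J \<noteq> \<top>" by (auto simp: ennreal_mult_top split: if_splits)
  with pq have "p = q" by (metis ennreal_mult_cancel_left ennreal_mult_divide_eq)
  then show ?thesis by simp
qed

text \<open>The substitution \<open>y = T x\<close> turns \<open>\<langle>x, X\<^sup>-\<^sup>1 x\<rangle>\<close> into \<open>\<langle>y, (T X T\<^sup>t)\<^sup>-\<^sup>1 y\<rangle>\<close>. So both measures have densities
  proportional to the same function, and both have total mass one.\<close>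

theorem distr_G_phi_matrix:
  fixes T X :: "real^'n^'n"
  assumes \<phi>: "\<phi> \<in> phi_class a" and const: "phi_constants TYPE('n) \<phi> l c"
    and T: "invertible T" and X: "X \<in> spd"
  shows "distr (G_phi \<phi> l c 0 X) borel ((*v) T) = G_phi \<phi> l c 0 (T ** X ** transpose T)"
proof -
  let ?Y = "T ** X ** transpose T"
  define h where "h V x = exp_phi \<phi> (l - c * (x \<bullet> (matrix_inv V *v x)))" for V and x :: "real^'n"
  define \<kappa> where "\<kappa> V = ennreal (det V powr (-1/2))" for V :: "real^'n^'n"
  have h [measurable]: "h V \<in> borel_measurable borel" for V
    using borel_measurable_exp_phi_quadratic[OF \<phi>, of l c 0 "matrix_inv V"] by (simp add: h_def[abs_def])
  have G: "G_phi \<phi> l c 0 V = density lborel (\<lambda>x. \<kappa> V * h V x)" for V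
    by (simp add: G_phi_def g_phi_def[abs_def] h_def \<kappa>_def mult.commute)
  have "x = 0" if "transpose T *v x = 0" for x
    using T that by (metis invertible_def matrix_left_invertible_ker transpose_invertible)
  then have Y: "?Y \<in> spd"
    using spd_congruence[OF X, of "transpose T"] by (simp only: transpose_transpose)
  obtain k where k: "distr lborel borel ((*v) T) = density lborel (\<lambda>_. k)"
    using distr_lborel_matrix[OF T] by blast
  have hY: "h ?Y (T *v x) = h X x" for x
    using matrix_inv_congruence_form[OF T spd_invertible[OF X]] by (simp add: h_def)
  have "distr (G_phi \<phi> l c 0 X) borel ((*v) T)
      = distr (density lborel (\<lambda>x. \<kappa> X * h ?Y (T *v x))) borel ((*v) T)"
    by (simp add: G hY)
  also have "\<dots> = density (distr lborel borel ((*v) T)) (\<lambda>x. \<kappa> X * h ?Y x)"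
    by (rule density_distr[symmetric]) measurable
  also have "\<dots> = density lborel (\<lambda>x. (k * \<kappa> X) * h ?Y x)"
    unfolding k by (subst density_density_eq) (auto simp: mult_ac)
  finally have eq: "distr (G_phi \<phi> l c 0 X) borel ((*v) T) = density lborel (\<lambda>x. (k * \<kappa> X) * h ?Y x)" .
  have prob: "prob_space (G_phi \<phi> l c 0 V)" if "V \<in> spd" for V :: "real^'n^'n"
    using const that by (simp add: phi_constants_def)
  have "prob_space (distr (G_phi \<phi> l c 0 X) borel ((*v) T))"
    by (rule prob_space.prob_space_distr[OF prob[OF X]]) (simp add: G)
  then have "prob_space (density lborel (\<lambda>x. (k * \<kappa> X) * h ?Y x))" by (simp only: eq)
  then have "density lborel (\<lambda>x. (k * \<kappa> X) * h ?Y x) = density lborel (\<lambda>x. \<kappa> ?Y * h ?Y x)"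
    using prob[OF Y] by (intro density_proportional_prob_eq) (simp_all add: G)
  then show ?thesis by (simp only: eq G[of ?Y])
qed

lemma G_phi_P2:
  fixes V :: "real^'n^'n"
  assumes "phi_constants TYPE('n) \<phi> l c" "V \<in> spd"
  shows "G_phi \<phi> l c 0 V \<in> P2"
proof -
  have G: "prob_space (G_phi \<phi> l c 0 V)" "has_mean_covariance (G_phi \<phi> l c 0 V) 0 V"
    using assms by (simp_all add: phi_constants_def)
  have "integrable (G_phi \<phi> l c 0 V) (\<lambda>x. \<Sum>i\<in>UNIV. x $ i * x $ i)"
    using G(2) by (intro Bochner_Integration.integrable_sum) (simp add: has_mean_covariance_def)
  then have "integrable (G_phi \<phi> l c 0 V) (\<lambda>x. (norm x)\<^sup>2)"
    by (simp add: power2_norm_eq_inner inner_vec_def)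
  then show ?thesis using G(1) by (simp add: P2_def G_phi_def)
qed

section \<open>Couplings and vanishing Wasserstein distance\<close>

lemma couplingsD:
  assumes "\<pi> \<in> couplings \<mu> \<nu>"
  shows "prob_space \<pi>" "sets \<pi> = sets borel" "distr \<pi> borel fst = \<mu>" "distr \<pi> borel snd = \<nu>"
  using assms by (auto simp: couplings_def)

lemma couplings_measurable:
  assumes "\<pi> \<in> couplings \<mu> \<nu>"
  shows "fst \<in> \<pi> \<rightarrow>\<^sub>M borel" "snd \<in> \<pi> \<rightarrow>\<^sub>M borel"
  using couplingsD(2)[OF assms]
  by (simp_all add: measurable_cong_sets[OF couplingsD(2)[OF assms] refl] borel_prod[symmetric])

lemma couplings_swap:
  assumes "\<pi> \<in> couplings \<mu> \<nu>"
  shows "distr \<pi> borel (\<lambda>p. (snd p, fst p)) \<in> couplings \<nu> \<mu>"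
proof -
  note [measurable] = couplings_measurable[OF assms]
  have sw [measurable]: "(\<lambda>p. (snd p, fst p)) \<in> \<pi> \<rightarrow>\<^sub>M borel" by (simp add: borel_prod[symmetric])
  show ?thesis
    using couplingsD[OF assms] prob_space.prob_space_distr[OF couplingsD(1)[OF assms] sw]
    by (auto simp: couplings_def distr_distr o_def borel_prod[symmetric])
qed

lemma couplings_image_snd:
  fixes f :: "real^'n \<Rightarrow> real^'n"
  assumes \<pi>: "\<pi> \<in> couplings \<mu> \<nu>" and f [measurable]: "f \<in> borel_measurable borel"
  shows "distr \<pi> borel (\<lambda>p. (fst p, f (snd p))) \<in> couplings \<mu> (distr \<nu> borel f)"
proof -
  note [measurable] = couplings_measurable[OF \<pi>]
  have sw [measurable]: "(\<lambda>p. (fst p, f (snd p))) \<in> \<pi> \<rightarrow>\<^sub>M borel" by (simp add: borel_prod[symmetric])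
  have "distr \<nu> borel f = distr \<pi> borel (\<lambda>p. f (snd p))"
    unfolding couplingsD(4)[OF \<pi>, symmetric] by (simp add: distr_distr o_def)
  then show ?thesis
    using couplingsD[OF \<pi>] prob_space.prob_space_distr[OF couplingsD(1)[OF \<pi>] sw]
    by (auto simp: couplings_def distr_distr o_def borel_prod[symmetric])
qed

lemma W2_squared_commute: "W2_squared \<mu> \<nu> = W2_squared \<nu> \<mu>"
proof -
  have le: "W2_squared \<nu> \<mu> \<le> W2_squared \<mu> \<nu>" for \<mu> \<nu> :: "(real^'n) measure"
    unfolding W2_squared_def[of \<mu> \<nu>]
  proof (rule INF_greatest)
    fix \<pi> assume \<pi>: "\<pi> \<in> couplings \<mu> \<nu>"
    note [measurable] = couplings_measurable[OF \<pi>]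
    have sw [measurable]: "(\<lambda>p. (snd p, fst p)) \<in> \<pi> \<rightarrow>\<^sub>M borel" by (simp add: borel_prod[symmetric])
    have "W2_squared \<nu> \<mu> \<le> (\<integral>\<^sup>+ p. ennreal ((norm (fst p - snd p))\<^sup>2) \<partial>distr \<pi> borel (\<lambda>p. (snd p, fst p)))"
      unfolding W2_squared_def by (rule INF_lower[OF couplings_swap[OF \<pi>]])
    also have "\<dots> = (\<integral>\<^sup>+ p. ennreal ((norm (fst p - snd p))\<^sup>2) \<partial>\<pi>)"
      by (subst nn_integral_distr) (auto simp: norm_minus_commute borel_prod[symmetric])
    finally show "W2_squared \<nu> \<mu> \<le> (\<integral>\<^sup>+ p. ennreal ((norm (fst p - snd p))\<^sup>2) \<partial>\<pi>)" .
  qed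
  show ?thesis by (intro antisym le)
qed

text \<open>Markov's inequality: under \<open>\<pi>\<close>, a point of \<open>F\<close> is moved by at most \<open>d\<close> except on a set of measure at most
  the cost divided by \<open>d\<^sup>2\<close>.\<close>

lemma coupling_closed_set_bound:
  fixes F :: "(real^'n) set"
  assumes \<pi>: "\<pi> \<in> couplings \<mu> \<nu>" and F: "closed F" and d: "0 < d"
  shows "emeasure \<mu> F \<le> emeasure \<nu> {x. infdist x F \<le> d}
      + ennreal (1 / d\<^sup>2) * (\<integral>\<^sup>+ p. ennreal ((norm (fst p - snd p))\<^sup>2) \<partial>\<pi>)"
proof -
  note [measurable] = couplings_measurable[OF \<pi>]
  let ?q = "\<lambda>p::(real^'n) \<times> (real^'n). ennreal ((norm (fst p - snd p))\<^sup>2)"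
  have sp: "space \<pi> = UNIV" using sets_eq_imp_space_eq[OF couplingsD(2)[OF \<pi>]] by simp
  have cl: "closed {x. infdist x F \<le> d}" by (intro closed_Collect_le continuous_intros)
  have mF: "fst -` F \<inter> space \<pi> \<in> sets \<pi>" "snd -` {x. infdist x F \<le> d} \<inter> space \<pi> \<in> sets \<pi>"
    by (rule measurable_sets[OF couplings_measurable(1)[OF \<pi>] borel_closed[OF F]],
        rule measurable_sets[OF couplings_measurable(2)[OF \<pi>] borel_closed[OF cl]])
  have far: "{p \<in> space \<pi>. 1 \<le> ennreal (1 / d\<^sup>2) * ?q p} \<in> sets \<pi>" by measurable
  have "emeasure \<mu> F = emeasure \<pi> (fst -` F \<inter> space \<pi>)"
    using F by (subst couplingsD(3)[OF \<pi>, symmetric]) (simp add: emeasure_distr borel_closed)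
  also have "\<dots> \<le> emeasure \<pi> ((snd -` {x. infdist x F \<le> d} \<inter> space \<pi>) \<union> {p \<in> space \<pi>. 1 \<le> ennreal (1 / d\<^sup>2) * ?q p})"
  proof (rule emeasure_mono)
    show "fst -` F \<inter> space \<pi> \<subseteq> (snd -` {x. infdist x F \<le> d} \<inter> space \<pi>) \<union> {p \<in> space \<pi>. 1 \<le> ennreal (1 / d\<^sup>2) * ?q p}"
    proof
      fix p assume p: "p \<in> fst -` F \<inter> space \<pi>"
      show "p \<in> (snd -` {x. infdist x F \<le> d} \<inter> space \<pi>) \<union> {p \<in> space \<pi>. 1 \<le> ennreal (1 / d\<^sup>2) * ?q p}"
      proof (cases "norm (fst p - snd p) \<le> d")
        case True
        then have "infdist (snd p) F \<le> d"
          using p infdist_le[of "fst p" F "snd p"] by (simp add: dist_norm norm_minus_commute)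
        then show ?thesis using sp by simp
      next
        case False
        then have "d\<^sup>2 \<le> (norm (fst p - snd p))\<^sup>2" using d by (intro power_mono) auto
        then have "1 \<le> 1 / d\<^sup>2 * (norm (fst p - snd p))\<^sup>2" using d by (simp add: divide_simps)
        then have "ennreal 1 \<le> ennreal (1 / d\<^sup>2 * (norm (fst p - snd p))\<^sup>2)" by (rule ennreal_leI)
        also have "\<dots> = ennreal (1 / d\<^sup>2) * ?q p" by (rule ennreal_mult') simp
        finally have "1 \<le> ennreal (1 / d\<^sup>2) * ?q p" by simp
        then show ?thesis using sp by simp
      qed
    qed
  qed (use mF far in auto)
  also have "\<dots> \<le> emeasure \<pi> (snd -` {x. infdist x F \<le> d} \<inter> space \<pi>) + emeasure \<pi> {p \<in> space \<pi>. 1 \<le> ennreal (1 / d\<^sup>2) * ?q p}"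
    by (rule emeasure_subadditive[OF mF(2) far])
  also have "emeasure \<pi> (snd -` {x. infdist x F \<le> d} \<inter> space \<pi>) = emeasure \<nu> {x. infdist x F \<le> d}"
    using cl by (subst couplingsD(4)[OF \<pi>, symmetric]) (simp add: emeasure_distr borel_closed)
  also have "emeasure \<pi> {p \<in> space \<pi>. 1 \<le> ennreal (1 / d\<^sup>2) * ?q p} \<le> ennreal (1 / d\<^sup>2) * (\<integral>\<^sup>+ p. ?q p \<partial>\<pi>)"
    using nn_integral_Markov_inequality[where u = ?q and A = "space \<pi>" and M = \<pi> and c = "ennreal (1 / d\<^sup>2)"]
    by (simp add: sp couplingsD(2)[OF \<pi>])
  finally show ?thesis by (simp add: add_left_mono)
qed

text \<open>Couplings of vanishing cost bound \<open>\<mu> F\<close> by the \<open>\<nu>\<close>-measure of every closed neighbourhood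
  \<open>{x. infdist x F \<le> d}\<close>; these shrink to \<open>F\<close>.\<close>

lemma W2_squared_zero_closed_le:
  fixes F :: "(real^'n) set"
  assumes \<nu>: "prob_space \<nu>" "sets \<nu> = sets borel" and W: "W2_squared \<mu> \<nu> = 0" and F: "closed F" "F \<noteq> {}"
  shows "emeasure \<mu> F \<le> emeasure \<nu> F"
proof -
  interpret \<nu>: prob_space \<nu> by (rule \<nu>(1))
  let ?N = "\<lambda>d. {x. infdist x F \<le> d}"
  have cl: "closed (?N d)" for d by (intro closed_Collect_le continuous_intros)
  have le: "emeasure \<mu> F \<le> emeasure \<nu> (?N d)" if d: "0 < d" for d
  proof (rule ennreal_le_epsilon)
    fix e :: real assume e: "0 < e"
    then have "W2_squared \<mu> \<nu> < ennreal (e * d\<^sup>2)" using W d by simp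
    then obtain \<pi> where \<pi>: "\<pi> \<in> couplings \<mu> \<nu>"
      and small: "(\<integral>\<^sup>+ p. ennreal ((norm (fst p - snd p))\<^sup>2) \<partial>\<pi>) < ennreal (e * d\<^sup>2)"
      by (auto simp: W2_squared_def INF_less_iff)
    have "ennreal (1 / d\<^sup>2) * (\<integral>\<^sup>+ p. ennreal ((norm (fst p - snd p))\<^sup>2) \<partial>\<pi>) \<le> ennreal (1 / d\<^sup>2) * ennreal (e * d\<^sup>2)"
      using small by (intro mult_left_mono) auto
    also have "\<dots> = ennreal e" using d e by (simp add: ennreal_mult[symmetric])
    finally show "emeasure \<mu> F \<le> emeasure \<nu> (?N d) + ennreal e"
      using coupling_closed_set_bound[OF \<pi> F(1) d] by (meson add_left_mono order_trans)
  qed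
  have "(\<lambda>k. emeasure \<nu> (?N (1 / real (Suc k)))) \<longlonglongrightarrow> emeasure \<nu> (\<Inter>k. ?N (1 / real (Suc k)))"
  proof (rule Lim_emeasure_decseq)
    show "range (\<lambda>k. ?N (1 / real (Suc k))) \<subseteq> sets \<nu>" using cl \<nu>(2) by (auto intro: borel_closed)
    have "1 / real (Suc k) \<le> 1 / real (Suc j)" if "j \<le> k" for j k
      using that by (simp add: divide_simps)
    then show "decseq (\<lambda>k. ?N (1 / real (Suc k)))"
      unfolding decseq_def by (auto intro: order_trans)
  qed simp
  moreover have "(\<Inter>k. ?N (1 / real (Suc k))) = F"
  proof (intro set_eqI iffI)
    fix x assume x: "x \<in> (\<Inter>k. ?N (1 / real (Suc k)))"
    have "infdist x F \<le> 0"
    proof (rule field_le_epsilon)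
      fix e :: real assume "0 < e"
      then obtain k where "inverse (real (Suc k)) < e" using reals_Archimedean by blast
      with x show "infdist x F \<le> 0 + e" by (auto simp: inverse_eq_divide dest: less_imp_le intro: order_trans)
    qed
    then show "x \<in> F" using in_closed_iff_infdist_zero[OF F] infdist_nonneg[of x F] by simp
  qed (use F in auto)
  ultimately have "(\<lambda>k. emeasure \<nu> (?N (1 / real (Suc k)))) \<longlonglongrightarrow> emeasure \<nu> F" by simp
  then show ?thesis by (rule LIMSEQ_le_const) (use le in auto)
qed

text \<open>By symmetry the two measures agree on closed sets, which generate the Borel sets and are
  stable under intersection.\<close>

theorem W2_squared_zero_imp_eq:
  fixes \<mu> \<nu> :: "(real^'n) measure"
  assumes \<mu>: "prob_space \<mu>" "sets \<mu> = sets borel" and \<nu>: "prob_space \<nu>" "sets \<nu> = sets borel"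
    and W: "W2_squared \<mu> \<nu> = 0"
  shows "\<mu> = \<nu>"
proof (rule measure_eqI_generator_eq[where E = "Collect closed" and \<Omega> = UNIV and A = "\<lambda>_. UNIV"])
  show "Int_stable (Collect closed :: (real^'n) set set)" by (auto simp: Int_stable_def)
  have gen: "sets borel = sigma_sets UNIV (Collect closed :: (real^'n) set set)"
    by (subst borel_eq_closed) (simp add: sets_measure_of)
  then show "sets \<mu> = sigma_sets UNIV (Collect closed)" "sets \<nu> = sigma_sets UNIV (Collect closed)"
    using \<mu> \<nu> by simp_all
  show "emeasure \<mu> UNIV \<noteq> \<infinity>"
    using prob_space.emeasure_space_1[OF \<mu>(1)] sets_eq_imp_space_eq[OF \<mu>(2)] by simp
  fix F :: "(real^'n) set" assume "F \<in> Collect closed"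
  then show "emeasure \<mu> F = emeasure \<nu> F"
    using W2_squared_zero_closed_le[OF \<nu> W, of F] W2_squared_zero_closed_le[OF \<mu>, of \<nu> F] W
    by (cases "F = {}") (auto simp: W2_squared_commute[of \<nu> \<mu>])
qed auto

section \<open>Transport cost and quadratic potentials\<close>

text \<open>The integral of the dual potential attached to the matrix \<open>T\<close>.\<close>

definition quadratic_gap :: "(real^'n) measure \<Rightarrow> real^'n^'n \<Rightarrow> real" where
  "quadratic_gap \<mu> T = (\<integral>x. (norm x)\<^sup>2 - x \<bullet> (T *v x) \<partial>\<mu>)"

text \<open>The slack at \<open>p = (x, y)\<close> in the inequality
  \<open>2 \<langle>x, y\<rangle> \<le> \<langle>x, T x\<rangle> + \<langle>y, T\<^sup>-\<^sup>1 y\<rangle>\<close>; for positive definite \<open>T\<close> it vanishes exactly when \<open>y = T x\<close>.\<close>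

definition displacement_defect :: "real^'n^'n \<Rightarrow> (real^'n) \<times> (real^'n) \<Rightarrow> real" where
  "displacement_defect T p = (fst p - matrix_inv T *v snd p) \<bullet> (T *v (fst p - matrix_inv T *v snd p))"

lemma P2_D:
  assumes "\<mu> \<in> P2"
  shows "prob_space \<mu>" "sets \<mu> = sets borel" "integrable \<mu> (\<lambda>x. (norm x)\<^sup>2)"
  using assms by (auto simp: P2_def)

lemma borel_measurable_quadratic [measurable]:
  "(\<lambda>x. x \<bullet> (T *v x)) \<in> borel_measurable borel" for T :: "real^'n^'n"
  by (intro borel_measurable_continuous_onI continuous_intros)

lemma P2_integrable_quadratic:
  fixes T :: "real^'n^'n"
  assumes "\<mu> \<in> P2"
  shows "integrable \<mu> (\<lambda>x. x \<bullet> (T *v x))"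
proof (rule Bochner_Integration.integrable_bound)
  show "integrable \<mu> (\<lambda>x. onorm ((*v) T) * (norm x)\<^sup>2)" using P2_D(3)[OF assms] by simp
  show "(\<lambda>x. x \<bullet> (T *v x)) \<in> borel_measurable \<mu>"
    by (simp add: measurable_cong_sets[OF P2_D(2)[OF assms] refl])
  have "norm (x \<bullet> (T *v x)) \<le> norm (onorm ((*v) T) * (norm x)\<^sup>2)" for x
  proof -
    have "\<bar>x \<bullet> (T *v x)\<bar> \<le> norm x * norm (T *v x)" by (rule Cauchy_Schwarz_ineq2)
    also have "\<dots> \<le> norm x * (onorm ((*v) T) * norm x)"
      by (intro mult_left_mono onorm) (auto intro: matrix_vector_mul_bounded_linear)
    finally show ?thesis by (simp add: power2_eq_square mult_ac)
  qed
  then show "AE x in \<mu>. norm (x \<bullet> (T *v x)) \<le> norm (onorm ((*v) T) * (norm x)\<^sup>2)" by simp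
qed

lemma P2_distr_matrix:
  fixes T :: "real^'n^'n"
  assumes \<mu>: "\<mu> \<in> P2"
  shows "distr \<mu> borel ((*v) T) \<in> P2"
proof -
  have T: "(*v) T \<in> \<mu> \<rightarrow>\<^sub>M borel" by (simp add: measurable_cong_sets[OF P2_D(2)[OF \<mu>] refl])
  have "(norm (T *v x))\<^sup>2 = x \<bullet> ((transpose T ** T) *v x)" for x
    by (simp only: power2_norm_eq_inner matrix_vector_mul_assoc[symmetric]
        inner_matrix_vector_transpose[of x "transpose T"] transpose_transpose)
  then have "integrable \<mu> (\<lambda>x. (norm (T *v x))\<^sup>2)"
    using P2_integrable_quadratic[OF \<mu>] by simp
  then show ?thesis
    using prob_space.prob_space_distr[OF P2_D(1)[OF \<mu>] T] T by (simp add: P2_def integrable_distr_eq)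
qed

text \<open>The pointwise identity
  \<open>|x - y|\<^sup>2 = (|x|\<^sup>2 - \<langle>x, T x\<rangle>) + (|y|\<^sup>2 - \<langle>y, T\<^sup>-\<^sup>1 y\<rangle>) + \<langle>x - T\<^sup>-\<^sup>1 y, T (x - T\<^sup>-\<^sup>1 y)\<rangle>\<close>, integrated. The two brackets
  see only the marginals, so the coupling enters through the defect alone.\<close>

lemma coupling_integral_eq:
  fixes T :: "real^'n^'n"
  assumes \<mu>: "\<mu> \<in> P2" and \<nu>: "\<nu> \<in> P2" and \<pi>: "\<pi> \<in> couplings \<mu> \<nu>" and T: "T \<in> spd"
  shows "(\<integral>\<^sup>+ p. ennreal ((norm (fst p - snd p))\<^sup>2) \<partial>\<pi>)
      = ennreal (quadratic_gap \<mu> T + quadratic_gap \<nu> (matrix_inv T) + (\<integral>p. displacement_defect T p \<partial>\<pi>))"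
    and "0 \<le> quadratic_gap \<mu> T + quadratic_gap \<nu> (matrix_inv T) + (\<integral>p. displacement_defect T p \<partial>\<pi>)"
    and "integrable \<pi> (displacement_defect T)"
proof -
  let ?U = "matrix_inv T"
  let ?f = "\<lambda>x. (norm x)\<^sup>2 - x \<bullet> (T *v x)" and ?g = "\<lambda>y. (norm y)\<^sup>2 - y \<bullet> (?U *v y)"
  let ?c = "\<lambda>p::(real^'n) \<times> (real^'n). (norm (fst p - snd p))\<^sup>2"
  note [measurable] = couplings_measurable[OF \<pi>]
  have TU: "T *v (?U *v y) = y" for y
    using T by (simp add: matrix_vector_mul_assoc matrix_inv_right spd_invertible)
  have split: "?c p = ?f (fst p) + ?g (snd p) + displacement_defect T p" for p
  proof -
    have "(?U *v snd p) \<bullet> (T *v fst p) = snd p \<bullet> fst p"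
      using spd_inner[OF T] TU by simp
    then show ?thesis
      by (simp add: displacement_defect_def matrix_vector_mult_diff_distrib TU inner_diff_left
          inner_diff_right power2_norm_eq_inner inner_commute)
  qed
  have fint: "integrable \<pi> (\<lambda>p. h (fst p))" and feq: "(\<integral>p. h (fst p) \<partial>\<pi>) = (\<integral>x. h x \<partial>\<mu>)"
    if "integrable \<mu> h" "h \<in> borel_measurable borel" for h :: "real^'n \<Rightarrow> real"
    using that unfolding couplingsD(3)[OF \<pi>, symmetric] by (simp_all add: integrable_distr_eq integral_distr)
  have gint: "integrable \<pi> (\<lambda>p. h (snd p))" and geq: "(\<integral>p. h (snd p) \<partial>\<pi>) = (\<integral>x. h x \<partial>\<nu>)"
    if "integrable \<nu> h" "h \<in> borel_measurable borel" for h :: "real^'n \<Rightarrow> real"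
    using that unfolding couplingsD(4)[OF \<pi>, symmetric] by (simp_all add: integrable_distr_eq integral_distr)
  have f: "integrable \<mu> ?f" "?f \<in> borel_measurable borel"
    using P2_integrable_quadratic[OF \<mu>] P2_D(3)[OF \<mu>] by auto
  have g: "integrable \<nu> ?g" "?g \<in> borel_measurable borel"
    using P2_integrable_quadratic[OF \<nu>] P2_D(3)[OF \<nu>] by auto
  have cint: "integrable \<pi> ?c"
  proof (rule Bochner_Integration.integrable_bound)
    show "integrable \<pi> (\<lambda>p. 2 * (norm (fst p))\<^sup>2 + 2 * (norm (snd p))\<^sup>2)"
      using fint[of "\<lambda>x. (norm x)\<^sup>2"] gint[of "\<lambda>x. (norm x)\<^sup>2"] P2_D(3)[OF \<mu>] P2_D(3)[OF \<nu>] by simp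
    have "(norm (x - y))\<^sup>2 \<le> 2 * (norm x)\<^sup>2 + 2 * (norm y)\<^sup>2" for x y :: "real^'n"
      using inner_ge_zero[of "x + y"]
      by (simp add: power2_norm_eq_inner inner_diff_left inner_diff_right inner_add_left inner_add_right)
    then show "AE p in \<pi>. norm (?c p) \<le> norm (2 * (norm (fst p))\<^sup>2 + 2 * (norm (snd p))\<^sup>2)" by simp
  qed measurable
  have "integrable \<pi> (\<lambda>p. ?c p - ?f (fst p) - ?g (snd p))"
    by (intro Bochner_Integration.integrable_diff cint fint[OF f] gint[OF g])
  then show qint: "integrable \<pi> (displacement_defect T)" by (simp add: split)
  have "(\<integral>p. ?c p \<partial>\<pi>) = (\<integral>p. ?f (fst p) \<partial>\<pi>) + (\<integral>p. ?g (snd p) \<partial>\<pi>) + (\<integral>p. displacement_defect T p \<partial>\<pi>)"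
    unfolding split using fint[OF f] gint[OF g] qint by simp
  then have eq: "(\<integral>p. ?c p \<partial>\<pi>) = quadratic_gap \<mu> T + quadratic_gap \<nu> ?U + (\<integral>p. displacement_defect T p \<partial>\<pi>)"
    by (simp only: feq[OF f] geq[OF g] quadratic_gap_def)
  show "(\<integral>\<^sup>+ p. ennreal (?c p) \<partial>\<pi>)
      = ennreal (quadratic_gap \<mu> T + quadratic_gap \<nu> ?U + (\<integral>p. displacement_defect T p \<partial>\<pi>))"
    using cint by (simp only: eq[symmetric] nn_integral_eq_integral zero_le_power2) (simp add: nn_integral_eq_integral)
  show "0 \<le> quadratic_gap \<mu> T + quadratic_gap \<nu> ?U + (\<integral>p. displacement_defect T p \<partial>\<pi>)"
    unfolding eq[symmetric] by simp
qed

lemma ennreal_sum_le_sum_ennreal: "ennreal (\<Sum>i\<in>I. f i) \<le> (\<Sum>i\<in>I. ennreal (f i))"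
proof -
  have "ennreal (\<Sum>i\<in>I. f i) \<le> ennreal (\<Sum>i\<in>I. max 0 (f i))" by (intro ennreal_leI sum_mono) simp
  also have "\<dots> = (\<Sum>i\<in>I. ennreal (max 0 (f i)))" by (rule sum_ennreal[symmetric]) simp
  also have "\<dots> = (\<Sum>i\<in>I. ennreal (f i))" by (intro sum.cong) (auto simp: max_def ennreal_neg)
  finally show ?thesis .
qed

text \<open>The weighted potentials add up to \<open>|x|\<^sup>2 - \<langle>x, x\<rangle>\<close>, so no trace of the competitor is left.\<close>

lemma weighted_quadratic_gap_zero:
  fixes T :: "nat \<Rightarrow> real^'n^'n"
  assumes \<mu>: "\<mu> \<in> P2" and w: "(\<Sum>i\<in>I. w i) = 1" and wT: "(\<Sum>i\<in>I. w i *\<^sub>R T i) = mat 1"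
  shows "(\<Sum>i\<in>I. w i * quadratic_gap \<mu> (T i)) = 0"
proof -
  have int: "integrable \<mu> (\<lambda>x. (norm x)\<^sup>2 - x \<bullet> (T i *v x))" for i
    using P2_integrable_quadratic[OF \<mu>] P2_D(3)[OF \<mu>] by auto
  have "(\<Sum>i\<in>I. w i * quadratic_gap \<mu> (T i)) = (\<integral>x. (\<Sum>i\<in>I. w i * ((norm x)\<^sup>2 - x \<bullet> (T i *v x))) \<partial>\<mu>)"
    unfolding quadratic_gap_def using int by (subst Bochner_Integration.integral_sum) auto
  also have "\<dots> = (\<integral>x. 0 \<partial>\<mu>)"
  proof (rule Bochner_Integration.integral_cong[OF refl])
    fix x
    have lin: "linear (\<lambda>Z::real^'n^'n. Z *v x)"
      by (rule linearI) (simp_all add: matrix_vector_mult_add_rdistrib scaleR_matrix_vector_assoc)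
    have "(\<Sum>i\<in>I. w i *\<^sub>R (T i *v x)) = (\<Sum>i\<in>I. w i *\<^sub>R T i) *v x"
      by (simp only: linear_sum[OF lin] linear_scale[OF lin])
    then have "(\<Sum>i\<in>I. w i * (x \<bullet> (T i *v x))) = x \<bullet> x"
      by (simp add: wT inner_sum_right[symmetric] flip: inner_scaleR_right)
    then show "(\<Sum>i\<in>I. w i * ((norm x)\<^sup>2 - x \<bullet> (T i *v x))) = 0"
      by (simp add: right_diff_distrib sum_subtractf sum_distrib_right[symmetric] w power2_norm_eq_inner)
  qed
  finally show ?thesis by simp
qed

text \<open>The duality argument for the images of an arbitrary \<open>\<mu>\<close>. By \<open>coupling_integral_eq\<close> and
  \<open>weighted_quadratic_gap_zero\<close> the cost of a competitor is a constant \<open>K\<close> plus weighted defects. The fact \<open>lower\<close> in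
  the proof carries lower bounds \<open>e i\<close> for the defects: with \<open>e = 0\<close> it gives minimality, and with a
  positive bound at one index of positive weight it gives uniqueness.\<close>

theorem barycenter_of_linear_images:
  fixes T :: "nat \<Rightarrow> real^'n^'n"
  assumes \<mu>: "\<mu> \<in> P2" and w: "\<And>i. i \<in> {1..n} \<Longrightarrow> 0 \<le> w i" "(\<Sum>i=1..n. w i) = 1"
    and T: "\<And>i. i \<in> {1..n} \<Longrightarrow> T i \<in> spd" and wT: "(\<Sum>i=1..n. w i *\<^sub>R T i) = mat 1"
    and m: "\<And>i. i \<in> {1..n} \<Longrightarrow> m i = distr \<mu> borel ((*v) (T i))"
  shows "is_barycenter n w m \<nu> \<longleftrightarrow> \<nu> = \<mu>"
proof -
  let ?g = "\<lambda>\<nu> i. quadratic_gap \<nu> (T i) + quadratic_gap (m i) (matrix_inv (T i))"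
  define K where "K = (\<Sum>i=1..n. w i / 2 * quadratic_gap (m i) (matrix_inv (T i)))"
  have mP2: "m i \<in> P2" if "i \<in> {1..n}" for i using P2_distr_matrix[OF \<mu>] m[OF that] by simp
  have total: "(\<Sum>i=1..n. w i / 2 * ?g \<nu> i) = K" if "\<nu> \<in> P2" for \<nu>
  proof -
    have "(\<Sum>i=1..n. w i / 2 * ?g \<nu> i) = (\<Sum>i=1..n. w i * quadratic_gap \<nu> (T i)) / 2 + K"
      by (simp add: K_def distrib_left sum.distrib sum_divide_distrib)
    then show ?thesis using weighted_quadratic_gap_zero[OF that w(2) wT] by simp
  qed
  have defect_nonneg: "0 \<le> displacement_defect (T i) p" if "i \<in> {1..n}" for i p
    using spd_pos[OF T[OF that], of "fst p - matrix_inv (T i) *v snd p"]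
    by (cases "fst p - matrix_inv (T i) *v snd p = 0") (auto simp: displacement_defect_def)
  have lower: "ennreal (K + (\<Sum>i=1..n. w i / 2 * e i)) \<le> barycenter_cost n w m \<nu>"
    if \<nu>: "\<nu> \<in> P2" and e: "\<And>i \<pi>. i \<in> {1..n} \<Longrightarrow> \<pi> \<in> couplings \<nu> (m i) \<Longrightarrow> e i \<le> (\<integral>p. displacement_defect (T i) p \<partial>\<pi>)"
    for \<nu> e
  proof -
    have "K + (\<Sum>i=1..n. w i / 2 * e i) = (\<Sum>i=1..n. w i / 2 * (?g \<nu> i + e i))"
      by (simp add: total[OF \<nu>, symmetric] distrib_left sum.distrib)
    then have "ennreal (K + (\<Sum>i=1..n. w i / 2 * e i)) \<le> (\<Sum>i=1..n. ennreal (w i / 2 * (?g \<nu> i + e i)))"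
      by (simp only: ennreal_sum_le_sum_ennreal)
    also have "\<dots> = (\<Sum>i=1..n. ennreal (w i / 2) * ennreal (?g \<nu> i + e i))"
      using w(1) by (intro sum.cong refl ennreal_mult') simp
    also have "\<dots> \<le> barycenter_cost n w m \<nu>"
      unfolding barycenter_cost_def
    proof (intro sum_mono mult_left_mono)
      fix i assume i: "i \<in> {1..n}"
      show "ennreal (?g \<nu> i + e i) \<le> W2_squared \<nu> (m i)"
        unfolding W2_squared_def
      proof (rule INF_greatest)
        fix \<pi> assume \<pi>: "\<pi> \<in> couplings \<nu> (m i)"
        show "ennreal (?g \<nu> i + e i) \<le> (\<integral>\<^sup>+ p. ennreal ((norm (fst p - snd p))\<^sup>2) \<partial>\<pi>)"
          unfolding coupling_integral_eq(1)[OF \<nu> mP2[OF i] \<pi> T[OF i]]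
          using e[OF i \<pi>] by (intro ennreal_leI) simp
      qed
    qed simp
    finally show ?thesis .
  qed
  have inverse: "matrix_inv (T i) *v (T i *v x) = x" if "i \<in> {1..n}" for i x
    using T[OF that] by (simp add: matrix_vector_mul_assoc matrix_inv_left spd_invertible)
  have meas: "(*v) S \<in> \<mu> \<rightarrow>\<^sub>M borel" for S :: "real^'n^'n"
    by (simp add: measurable_cong_sets[OF P2_D(2)[OF \<mu>] refl])
  have attained: "0 \<le> ?g \<mu> i \<and> W2_squared \<mu> (m i) \<le> ennreal (?g \<mu> i)" if i: "i \<in> {1..n}" for i
  proof -
    let ?\<pi> = "distr \<mu> borel (\<lambda>x. (x, T i *v x))"
    have [measurable]: "(\<lambda>x. (x, T i *v x)) \<in> \<mu> \<rightarrow>\<^sub>M borel"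
      using meas[of "T i"] by (simp add: borel_prod[symmetric] measurable_cong_sets[OF P2_D(2)[OF \<mu>] refl])
    have \<pi>: "?\<pi> \<in> couplings \<mu> (m i)"
      using P2_D[OF \<mu>] m[OF i] by (auto simp: couplings_def distr_distr o_def distr_id2
          borel_prod[symmetric] intro!: prob_space.prob_space_distr)
    have "(\<integral>p. displacement_defect (T i) p \<partial>?\<pi>) = 0"
    proof -
      have "displacement_defect (T i) \<in> borel_measurable borel"
        using borel_measurable_integrable[OF coupling_integral_eq(3)[OF \<mu> mP2[OF i] \<pi> T[OF i]]] by simp
      then show ?thesis
        by (subst integral_distr) (auto simp: displacement_defect_def inverse[OF i])
    qed
    then show ?thesis
      using coupling_integral_eq(1,2)[OF \<mu> mP2[OF i] \<pi> T[OF i]]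
        INF_lower[OF \<pi>, where f = "\<lambda>\<pi>. \<integral>\<^sup>+ p. ennreal ((norm (fst p - snd p))\<^sup>2) \<partial>\<pi>"]
      unfolding W2_squared_def by simp
  qed
  have upper: "barycenter_cost n w m \<mu> \<le> ennreal K"
  proof -
    have "barycenter_cost n w m \<mu> \<le> (\<Sum>i=1..n. ennreal (w i / 2) * ennreal (?g \<mu> i))"
      unfolding barycenter_cost_def using attained by (intro sum_mono mult_left_mono) auto
    also have "\<dots> = (\<Sum>i=1..n. ennreal (w i / 2 * ?g \<mu> i))"
      using w(1) by (intro sum.cong refl ennreal_mult'[symmetric]) simp
    also have "\<dots> = ennreal (\<Sum>i=1..n. w i / 2 * ?g \<mu> i)"
      using w(1) attained by (intro sum_ennreal mult_nonneg_nonneg) auto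
    finally show ?thesis by (simp only: total[OF \<mu>])
  qed
  have "0 \<le> K"
    unfolding total[OF \<mu>, symmetric] using w(1) attained by (intro sum_nonneg mult_nonneg_nonneg) auto
  have minimal: "is_barycenter n w m \<mu>"
    unfolding is_barycenter_def
  proof (intro conjI ballI \<mu>)
    fix \<nu> :: "(real^'n) measure" assume "\<nu> \<in> P2"
    from lower[OF this, of "\<lambda>_. 0"] upper show "barycenter_cost n w m \<mu> \<le> barycenter_cost n w m \<nu>"
      using defect_nonneg by (auto intro: order_trans)
  qed
  have "\<nu> = \<mu>" if \<nu>: "is_barycenter n w m \<nu>" for \<nu>
  proof -
    have \<nu>P2: "\<nu> \<in> P2" and \<nu>le: "barycenter_cost n w m \<nu> \<le> ennreal K"
      using \<nu> upper \<mu> unfolding is_barycenter_def by (auto intro: order_trans)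
    obtain j where j: "j \<in> {1..n}" "0 < w j"
    proof -
      have "\<exists>j\<in>{1..n}. w j \<noteq> 0" using w(2) by (metis sum.neutral zero_neq_one)
      then show thesis using that w(1) by (metis order_le_less)
    qed
    \<comment> \<open>Coercivity of \<open>T j\<close>: the defect controls the squared distance from \<open>x\<close> to \<open>T\<^sub>j\<^sup>-\<^sup>1 y\<close>.\<close>
    obtain r b where r: "0 < r" "T j \<in> quad_between r b" using spd_in_quad_between[OF T[OF j(1)]] .
    have "W2_squared \<nu> \<mu> = 0"
    proof (rule ccontr)
      assume "W2_squared \<nu> \<mu> \<noteq> 0"
      then obtain e where e: "0 < e" "ennreal e \<le> W2_squared \<nu> \<mu>"
      proof (cases "W2_squared \<nu> \<mu>")
        case (real r)
        with \<open>W2_squared \<nu> \<mu> \<noteq> 0\<close> that[of r] show thesis by (cases "r = 0") auto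
      next
        case top
        with that[of 1] show thesis by simp
      qed
      have "r * e \<le> (\<integral>p. displacement_defect (T j) p \<partial>\<pi>)" if \<pi>: "\<pi> \<in> couplings \<nu> (m j)" for \<pi>
      proof -
        let ?U = "matrix_inv (T j)"
        note [measurable] = couplings_measurable[OF \<pi>]
        have dist: "distr (m j) borel ((*v) ?U) = \<mu>"
          using j(1) meas P2_D(2)[OF \<mu>] by (simp add: m distr_distr o_def inverse distr_id2)
        have [measurable]: "(\<lambda>p. (fst p, ?U *v snd p)) \<in> \<pi> \<rightarrow>\<^sub>M borel" by (simp add: borel_prod[symmetric])
        have "ennreal e \<le> (\<integral>\<^sup>+ p. ennreal ((norm (fst p - snd p))\<^sup>2) \<partial>distr \<pi> borel (\<lambda>p. (fst p, ?U *v snd p)))"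
          using e(2) couplings_image_snd[OF \<pi>, of "(*v) ?U"]
          unfolding dist W2_squared_def by (auto intro: order_trans INF_lower)
        also have "\<dots> = (\<integral>\<^sup>+ p. ennreal ((norm (fst p - ?U *v snd p))\<^sup>2) \<partial>\<pi>)"
          by (subst nn_integral_distr) (auto simp: borel_prod[symmetric])
        finally have "ennreal r * ennreal e \<le> ennreal r * (\<integral>\<^sup>+ p. ennreal ((norm (fst p - ?U *v snd p))\<^sup>2) \<partial>\<pi>)"
          by (rule mult_left_mono) simp
        also have "\<dots> = (\<integral>\<^sup>+ p. ennreal (r * (norm (fst p - ?U *v snd p))\<^sup>2) \<partial>\<pi>)"
          using r(1) by (subst nn_integral_cmult[symmetric]) (auto simp: ennreal_mult' less_imp_le)
        also have "\<dots> \<le> (\<integral>\<^sup>+ p. ennreal (displacement_defect (T j) p) \<partial>\<pi>)"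
          using r(2) by (intro nn_integral_mono ennreal_leI) (simp add: displacement_defect_def quad_between_def)
        also have "\<dots> = ennreal (\<integral>p. displacement_defect (T j) p \<partial>\<pi>)"
          using coupling_integral_eq(3)[OF \<nu>P2 mP2[OF j(1)] \<pi> T[OF j(1)]] defect_nonneg[OF j(1)]
          by (intro nn_integral_eq_integral) auto
        finally show ?thesis
          using defect_nonneg[OF j(1)] e r by (simp add: ennreal_mult'[symmetric] ennreal_le_iff integral_nonneg)
      qed
      then have "ennreal (K + (\<Sum>i=1..n. w i / 2 * (if i = j then r * e else 0))) \<le> barycenter_cost n w m \<nu>"
        using defect_nonneg by (intro lower[OF \<nu>P2]) auto
      also note \<nu>le
      finally have "K + w j / 2 * (r * e) \<le> K"
        using \<open>0 \<le> K\<close> j(1) by (simp add: ennreal_le_iff if_distrib cong: if_cong)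
      moreover have "0 < w j / 2 * (r * e)" using j(2) r(1) e(1) by simp
      ultimately show False by linarith
    qed
    then show ?thesis using W2_squared_zero_imp_eq P2_D \<mu> \<nu>P2 by blast
  qed
  with minimal show ?thesis by blast
qed

section \<open>The barycenter of deformed exponential measures\<close>

text \<open>Since \<open>S\<close> and \<open>T\<close> commute, \<open>(S X S) (T X T) = (S X T)\<^sup>2\<close>. The root \<open>S X T\<close> is the product of the positive
  definite matrices \<open>S X S\<close> and \<open>S\<^sup>-\<^sup>1 T\<close>, hence principal.\<close>

lemma principal_sqrt_commuting_congruences:
  fixes S T X :: "real^'n^'n"
  assumes S: "S \<in> spd" and T: "T \<in> spd" and X: "X \<in> spd" and comm: "S ** T = T ** S"
  shows "principal_sqrt ((S ** X ** S) ** (T ** X ** T)) = S ** X ** T"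
proof -
  let ?U = "matrix_inv S"
  have SU: "S ** ?U = mat 1" "?U ** S = mat 1"
    using S by (simp_all add: matrix_inv_left matrix_inv_right spd_invertible)
  have "?U ** T = ?U ** (T ** S) ** ?U" by (simp only: matrix_mul_assoc[symmetric] SU matrix_mul_rid)
  also have "\<dots> = T ** ?U" by (simp only: comm[symmetric] matrix_mul_assoc SU matrix_mul_lid)
  finally have "?U ** T \<in> spd" by (intro spd_mult_commuting spd_inverse S T)
  then have "principal_sqrt ((S ** X ** S ** (?U ** T)) ** (S ** X ** S ** (?U ** T))) = S ** X ** S ** (?U ** T)"
    by (intro principal_sqrt_spd_product spd_congruence_spd S X)
  moreover have "S ** X ** S ** (?U ** T) = S ** X ** ((S ** ?U) ** T)" by (simp only: matrix_mul_assoc)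
  then have "S ** X ** S ** (?U ** T) = S ** X ** T" by (simp only: SU matrix_mul_lid)
  moreover have "(S ** X ** T) ** (S ** X ** T) = S ** X ** (T ** S) ** X ** T" by (simp only: matrix_mul_assoc)
  then have "(S ** X ** T) ** (S ** X ** T) = (S ** X ** S) ** (T ** X ** T)"
    by (simp only: comm[symmetric] matrix_mul_assoc)
  ultimately show ?thesis by simp
qed

lemma matrix_add_rdistrib: "(B + C) ** A = B ** A + (C :: real^'n^'m) ** A"
  by (simp add: matrix_matrix_mult_def vec_eq_iff distrib_right sum.distrib)

lemma linear_matrix_sandwich: "linear (\<lambda>Z::real^'n^'n. B ** Z ** C)"
  by (rule linearI) (simp_all add: matrix_add_ldistrib matrix_add_rdistrib matrix_scalar_ac scalar_matrix_assoc)

text \<open>\<open>T i = R\<^sup>-\<^sup>1 (R A\<^sub>i R)\<^sup>1\<^sup>/\<^sup>2 R\<^sup>-\<^sup>1\<close> with \<open>R = X\<^sup>1\<^sup>/\<^sup>2\<close>; multiplying the matrix equation by \<open>R\<^sup>-\<^sup>1\<close> from both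
  sides turns it into \<open>\<Sum>\<^sub>i w\<^sub>i T\<^sub>i = I\<close>.\<close>

lemma transport_matrices:
  fixes A :: "'i \<Rightarrow> real^'n^'n"
  assumes X: "X \<in> spd" and A: "\<And>i. i \<in> I \<Longrightarrow> A i \<in> spd"
    and eq: "X = (\<Sum>i\<in>I. w i *\<^sub>R spd_sqrt (spd_sqrt X ** A i ** spd_sqrt X))"
  obtains T where "\<And>i. i \<in> I \<Longrightarrow> T i \<in> spd" "\<And>i. i \<in> I \<Longrightarrow> T i ** X ** T i = A i"
    "(\<Sum>i\<in>I. w i *\<^sub>R T i) = mat 1"
proof -
  define R where "R = spd_sqrt X"
  define U where "U = matrix_inv R"
  define S where "S i = spd_sqrt (R ** A i ** R)" for i
  have R: "R \<in> spd" "R ** R = X" using X by (simp_all add: R_def spd_sqrt_spd spd_sqrt_square)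
  have U: "U \<in> spd" "U ** R = mat 1" "R ** U = mat 1"
    using R by (simp_all add: U_def spd_inverse matrix_inv_left matrix_inv_right spd_invertible)
  have S: "S i \<in> spd" "S i ** S i = R ** A i ** R" if "i \<in> I" for i
    using spd_congruence_spd[OF A[OF that] R(1)] by (simp_all add: S_def spd_sqrt_spd spd_sqrt_square)
  have "(U ** S i ** U) ** X ** (U ** S i ** U) = A i" if "i \<in> I" for i
  proof -
    have "(U ** S i ** U) ** (R ** R) ** (U ** S i ** U) = U ** S i ** (U ** R) ** (R ** U) ** S i ** U"
      by (simp only: matrix_mul_assoc)
    also have "\<dots> = U ** (S i ** S i) ** U" by (simp only: U matrix_mul_rid matrix_mul_assoc)
    also have "\<dots> = (U ** R) ** A i ** (R ** U)" by (simp only: S(2)[OF that] matrix_mul_assoc)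
    finally show ?thesis by (simp only: R(2) U matrix_mul_rid matrix_mul_lid)
  qed
  moreover have "(\<Sum>i\<in>I. w i *\<^sub>R (U ** S i ** U)) = mat 1"
  proof -
    have "(\<Sum>i\<in>I. w i *\<^sub>R (U ** S i ** U)) = U ** (\<Sum>i\<in>I. w i *\<^sub>R S i) ** U"
      by (simp add: linear_sum[OF linear_matrix_sandwich] linear_scale[OF linear_matrix_sandwich])
    also have "(\<Sum>i\<in>I. w i *\<^sub>R S i) = R ** R" using eq by (simp only: S_def R(2) R_def[symmetric])
    also have "U ** (R ** R) ** U = (U ** R) ** (R ** U)" by (simp only: matrix_mul_assoc)
    finally show ?thesis by (simp only: U matrix_mul_lid)
  qed
  ultimately show thesis using that[of "\<lambda>i. U ** S i ** U"] spd_congruence_spd[OF S(1) U(1)] by blast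
qed

text \<open>Expand \<open>X = (a T\<^sub>1 + b T\<^sub>2) X (a T\<^sub>1 + b T\<^sub>2)\<close>. If \<open>b \<noteq> 0\<close>, then \<open>T\<^sub>2\<close> is a linear combination of \<open>I\<close> and \<open>T\<^sub>1\<close>, so
  the two commute and the mixed terms are principal roots; if \<open>b = 0\<close>, the mixed terms drop out.\<close>

lemma two_point_barycenter_matrix:
  fixes T\<^sub>1 T\<^sub>2 X :: "real^'n^'n"
  assumes T: "T\<^sub>1 \<in> spd" "T\<^sub>2 \<in> spd" and X: "X \<in> spd" and one: "a *\<^sub>R T\<^sub>1 + b *\<^sub>R T\<^sub>2 = mat 1"
    and A: "T\<^sub>1 ** X ** T\<^sub>1 = A\<^sub>1" "T\<^sub>2 ** X ** T\<^sub>2 = A\<^sub>2"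
  shows "X = a\<^sup>2 *\<^sub>R A\<^sub>1 + b\<^sup>2 *\<^sub>R A\<^sub>2 + (a * b) *\<^sub>R (principal_sqrt (A\<^sub>1 ** A\<^sub>2) + principal_sqrt (A\<^sub>2 ** A\<^sub>1))"
proof -
  have "X = (a *\<^sub>R T\<^sub>1 + b *\<^sub>R T\<^sub>2) ** X ** (a *\<^sub>R T\<^sub>1 + b *\<^sub>R T\<^sub>2)" by (simp only: one matrix_mul_lid matrix_mul_rid)
  also have "\<dots> = a\<^sup>2 *\<^sub>R (T\<^sub>1 ** X ** T\<^sub>1) + b\<^sup>2 *\<^sub>R (T\<^sub>2 ** X ** T\<^sub>2)
      + (a * b) *\<^sub>R (T\<^sub>1 ** X ** T\<^sub>2 + T\<^sub>2 ** X ** T\<^sub>1)"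
    by (simp add: matrix_add_ldistrib matrix_add_rdistrib matrix_scalar_ac scalar_matrix_assoc
        scaleR_add_right power2_eq_square mult.commute)
  finally have X_eq: "X = a\<^sup>2 *\<^sub>R A\<^sub>1 + b\<^sup>2 *\<^sub>R A\<^sub>2 + (a * b) *\<^sub>R (T\<^sub>1 ** X ** T\<^sub>2 + T\<^sub>2 ** X ** T\<^sub>1)"
    by (simp only: A)
  show ?thesis
  proof (cases "b = 0")
    case False
    have "T\<^sub>1 ** (a *\<^sub>R T\<^sub>1 + b *\<^sub>R T\<^sub>2) = (a *\<^sub>R T\<^sub>1 + b *\<^sub>R T\<^sub>2) ** T\<^sub>1" by (simp only: one matrix_mul_lid matrix_mul_rid)
    then have "b *\<^sub>R (T\<^sub>1 ** T\<^sub>2) = b *\<^sub>R (T\<^sub>2 ** T\<^sub>1)"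
      by (simp add: matrix_add_ldistrib matrix_add_rdistrib matrix_scalar_ac scalar_matrix_assoc)
    then have comm: "T\<^sub>1 ** T\<^sub>2 = T\<^sub>2 ** T\<^sub>1" using False by simp
    have "principal_sqrt (A\<^sub>1 ** A\<^sub>2) = T\<^sub>1 ** X ** T\<^sub>2" "principal_sqrt (A\<^sub>2 ** A\<^sub>1) = T\<^sub>2 ** X ** T\<^sub>1"
      using principal_sqrt_commuting_congruences[OF T X comm]
        principal_sqrt_commuting_congruences[OF T(2,1) X comm[symmetric]] by (simp_all only: A)
    then show ?thesis using X_eq by (simp only:)
  next
    case True
    then show ?thesis using X_eq by (simp only: mult_zero_right scaleR_zero_left)
  qed
qed

theorem theorem5p1:
  fixes n :: nat
    and \<phi> :: "real \<Rightarrow> real"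
    and lam c :: real
    and w :: "nat \<Rightarrow> real"
    and A :: "nat \<Rightarrow> real^'n^'n"
    and m :: "nat \<Rightarrow> (real^'n) measure"
  assumes "CARD('n) \<ge> 2"
    and "n \<ge> 1"
    and "\<phi> \<in> phi_class (2 / (real CARD('n) + 2))"
    and "phi_constants TYPE('n) \<phi> lam c"
    and "\<And>i. i \<in> {1..n} \<Longrightarrow> w i \<ge> 0"
    and "(\<Sum>i=1..n. w i) = 1"
    and "\<And>i. i \<in> {1..n} \<Longrightarrow> A i \<in> spd"
    and "\<And>i. i \<in> {1..n} \<Longrightarrow> m i = G_phi \<phi> lam c 0 (A i)"
  shows "\<exists>X\<in>spd.
     (\<forall>\<mu>. is_barycenter n w m \<mu> \<longleftrightarrow> \<mu> = G_phi \<phi> lam c 0 X) \<and>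
     X = (\<Sum>i=1..n. w i *\<^sub>R spd_sqrt (spd_sqrt X ** A i ** spd_sqrt X)) \<and>
     (n = 2 \<longrightarrow>
       X = (w 1)\<^sup>2 *\<^sub>R A 1 + (w 2)\<^sup>2 *\<^sub>R A 2
           + (w 1 * w 2) *\<^sub>R (principal_sqrt (A 1 ** A 2) + principal_sqrt (A 2 ** A 1)))"
proof -
  note \<phi> = assms(3,4) and w = assms(5,6) and A = assms(7) and m = assms(8)
  obtain X where X: "X \<in> spd"
    and X_eq: "X = (\<Sum>i=1..n. w i *\<^sub>R spd_sqrt (spd_sqrt X ** A i ** spd_sqrt X))"
    using barycenter_equation_solvable[OF finite_atLeastAtMost w A] .
  obtain T where T: "\<And>i. i \<in> {1..n} \<Longrightarrow> T i \<in> spd" "\<And>i. i \<in> {1..n} \<Longrightarrow> T i ** X ** T i = A i"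
    and wT: "(\<Sum>i=1..n. w i *\<^sub>R T i) = mat 1"
    using transport_matrices[OF X A X_eq] by blast
  have "m i = distr (G_phi \<phi> lam c 0 X) borel ((*v) (T i))" if "i \<in> {1..n}" for i
    using distr_G_phi_matrix[OF \<phi> spd_invertible[OF T(1)[OF that]] X]
    by (simp only: m[OF that] T(2)[OF that] spd_symmetric[OF T(1)[OF that]])
  then have "is_barycenter n w m \<mu> \<longleftrightarrow> \<mu> = G_phi \<phi> lam c 0 X" for \<mu>
    by (intro barycenter_of_linear_images[OF G_phi_P2[OF \<phi>(2) X] w T(1) wT])
  moreover have "X = (w 1)\<^sup>2 *\<^sub>R A 1 + (w 2)\<^sup>2 *\<^sub>R A 2
      + (w 1 * w 2) *\<^sub>R (principal_sqrt (A 1 ** A 2) + principal_sqrt (A 2 ** A 1))" if "n = 2"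
  proof -
    have "{1..n} = {1, 2}" using that by auto
    then show ?thesis
      using T wT by (intro two_point_barycenter_matrix[of "T 1" "T 2"] X) auto
  qed
  ultimately show ?thesis using X X_eq by blast
qed

end
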